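(* There exist germs at $(0,0)\in\mathbb{C}^2$ of singular, non-dicritical holomorphic foliations $\mathcal{F}$ which are compressible (that is, not incompressible).
   Context: A germ of singular holomorphic foliation $\mathcal{F}$ at $(0,0)\in\mathbb{C}^2$ is given by a germ of holomorphic 1-form $\omega=P\,dx-Q\,dy$ with $P,Q$ coprime and $P(0,0)=Q(0,0)=0$; its leaves integrate the distribution $\ker\omega$. It is non-dicritical if, in its reduction of singularities by point blow-ups, every component of the exceptional divisor is invariant by the transformed foliation. **Incompressible.** Let $\mathbb{D}$ be the open unit disc of $\mathbb{C}$, and let $\mathcal{B}$ be a closed Euclidean ball centred at the origin of sufficiently small radius. The germ $\mathcal{F}$ is called incompressible if there exist - a finite union $\mathcal{S}\subset\mathcal{B}$ of analytic curves invariant by $\mathcal{F}$ and containing the singularity, with equation $\mathcal{S}=\{f=0\}$ ($f$ holomorphic on a neighbourhood of $\mathcal{B}$); - a family of Milnor tubes $\mathcal{T}_\eta=f^{-1}(\eta\mathbb{D})\subset\mathcal{B}$, $0<\eta\le\eta_0$, of $\mathcal{S}$, on which $\mathcal{F}$ is well defined; - a neighbourhood $\mathcal{U}$ of the singularity; such that, with $\mathcal{T}:=\mathcal{T}_{\eta_0}$: 1. $\mathcal{U}\subset\mathcal{T}$, and this inclusion induces an isomorphism $\pi_1(\mathcal{U}\setminus\mathcal{S})\simeq\pi_1(\mathcal{T}\setminus\mathcal{S})$; 2. $\mathcal{T}_\eta\subset\mathcal{U}$ for every small enough $\eta$; 3. for every leaf $\mathcal{L}$ of $\mathcal{F}|_{\mathcal{U}\setminus\mathcal{S}}$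 the morphism $\pi_1(\mathcal{L})\to\pi_1(\mathcal{U}\setminus\mathcal{S})$ induced by the inclusion $\mathcal{L}\hookrightarrow\mathcal{U}\setminus\mathcal{S}$ is injective. *)

theory Defs
  imports "HOL-Analysis.Analysis" "HOL-Complex_Analysis.Complex_Analysis" "HOL-Algebra.Group"
begin

section \<open>Holomorphic functions of two variables and germs at the origin\<close>

type_synonym complex2 = "complex \<times> complex"

definition holomorphic2_on :: "(complex2 \<Rightarrow> complex) \<Rightarrow> complex2 set \<Rightarrow> bool"
    (infixl "holomorphic2'_on" 50) where
  "f holomorphic2_on U \<longleftrightarrow>
     open U \<and> (\<forall>z\<in>U. \<exists>a b. (f has_derivative (\<lambda>v. a * fst v + b * snd v)) (at z))"

definition holomorphic_germ :: "(complex2 \<Rightarrow> complex) \<Rightarrow> bool" where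
  "holomorphic_germ f \<longleftrightarrow> (\<exists>U. 0 \<in> U \<and> f holomorphic2_on U)"

definition pd1 :: "(complex2 \<Rightarrow> complex) \<Rightarrow> complex2 \<Rightarrow> complex" where
  "pd1 f z = deriv (\<lambda>x. f (x, snd z)) (fst z)"

definition pd2 :: "(complex2 \<Rightarrow> complex) \<Rightarrow> complex2 \<Rightarrow> complex" where
  "pd2 f z = deriv (\<lambda>y. f (fst z, y)) (snd z)"

text \<open>Coprimality in the ring of germs at the origin: every common factor is a unit, i.e.
  does not vanish at the origin.\<close>

definition coprime_germs :: "(complex2 \<Rightarrow> complex) \<Rightarrow> (complex2 \<Rightarrow> complex) \<Rightarrow> bool" where
  "coprime_germs P Q \<longleftrightarrow>
     (\<forall>h p q. holomorphic_germ h \<and> holomorphic_germ p \<and> holomorphic_germ q \<and>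
        (\<forall>\<^sub>F z in nhds 0. P z = h z * p z \<and> Q z = h z * q z) \<longrightarrow> h 0 \<noteq> 0)"


section \<open>Germs of foliations\<close>

text \<open>A pair \<open>P\<close>, \<open>Q\<close> stands for the germ at the origin of the foliation \<open>ker (P dx - Q dy)\<close>,
  which is also spanned by the vector field \<open>Q \<partial>/\<partial>x + P \<partial>/\<partial>y\<close>.  The functions are total;
  only their germs at the origin matter.\<close>

definition foliation_germ :: "(complex2 \<Rightarrow> complex) \<Rightarrow> (complex2 \<Rightarrow> complex) \<Rightarrow> bool" where
  "foliation_germ P Q \<longleftrightarrow> holomorphic_germ P \<and> holomorphic_germ Q \<and> coprime_germs P Q"

definition singular_germ :: "(complex2 \<Rightarrow> complex) \<Rightarrow> (complex2 \<Rightarrow> complex) \<Rightarrow> bool" where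
  "singular_germ P Q \<longleftrightarrow> P 0 = 0 \<and> Q 0 = 0"

text \<open>Reduced singularity: the eigenvalues \<open>\<mu>\<close>, \<open>\<nu>\<close> of the linear part of
  \<open>Q \<partial>/\<partial>x + P \<partial>/\<partial>y\<close> (the roots, with multiplicity, of its characteristic polynomial) are not
  both zero, and their ratio is not a positive rational number.\<close>

definition reduced_singularity :: "(complex2 \<Rightarrow> complex) \<Rightarrow> (complex2 \<Rightarrow> complex) \<Rightarrow> bool" where
  "reduced_singularity P Q \<longleftrightarrow> singular_germ P Q \<and>
     (\<exists>\<mu> \<nu>. \<mu> + \<nu> = pd1 Q 0 + pd2 P 0 \<and>
            \<mu> * \<nu> = pd1 Q 0 * pd2 P 0 - pd2 Q 0 * pd1 P 0 \<and>
            \<nu> \<noteq> 0 \<and> \<not> (\<exists>q::rat. q > 0 \<and> \<mu> / \<nu> = of_rat q))"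


subsection \<open>Blow-ups and non-dicritical foliations\<close>

text \<open>The blow-up of the origin has the charts \<open>(x, t) \<mapsto> (x, t x)\<close> and \<open>(s, y) \<mapsto> (s y, y)\<close>, with
  exceptional divisor \<open>{x = 0}\<close>, resp.\ \<open>{y = 0}\<close>.  The points of the divisor are the points
  \<open>(0, t)\<close> of the first chart and the origin of the second one.  The pulled-back form is
  \<open>(P - t Q) dx - x Q dt\<close>, resp.\ \<open>y P ds - (Q - s P) dy\<close>, with \<open>P\<close>, \<open>Q\<close> evaluated at the image
  point; the transformed foliation is given by \<open>A dx - B dt\<close>, resp.\ \<open>A ds - B dy\<close>, with coprime
  \<open>A\<close>, \<open>B\<close>, obtained by dividing out the power of the equation of the divisor.  In the first
  chart \<open>t = t0 + s\<close>, so that the point under consideration is again the origin.\<close>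

definition transform_at ::
  "complex \<Rightarrow> (complex2 \<Rightarrow> complex) \<Rightarrow> (complex2 \<Rightarrow> complex) \<Rightarrow>
   (complex2 \<Rightarrow> complex) \<Rightarrow> (complex2 \<Rightarrow> complex) \<Rightarrow> bool" where
  "transform_at t0 P Q A B \<longleftrightarrow> foliation_germ A B \<and>
     (\<exists>m. \<forall>\<^sub>F (x, s) in nhds (0, 0).
        x ^ m * A (x, s) = P (x, (t0 + s) * x) - (t0 + s) * Q (x, (t0 + s) * x) \<and>
        x ^ m * B (x, s) = x * Q (x, (t0 + s) * x))"

definition transform_at_infinity ::
  "(complex2 \<Rightarrow> complex) \<Rightarrow> (complex2 \<Rightarrow> complex) \<Rightarrow>
   (complex2 \<Rightarrow> complex) \<Rightarrow> (complex2 \<Rightarrow> complex) \<Rightarrow> bool" where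
  "transform_at_infinity P Q A B \<longleftrightarrow> foliation_germ A B \<and>
     (\<exists>m. \<forall>\<^sub>F (s, y) in nhds (0, 0).
        y ^ m * A (s, y) = y * P (s * y, y) \<and>
        y ^ m * B (s, y) = Q (s * y, y) - s * P (s * y, y))"

text \<open>The reduction of singularities blows up every singular point that is not reduced, and stops
  (Seidenberg) when none is left.  Each blow-up creates one component of the exceptional divisor;
  it is invariant by the transformed foliation iff the transformed form vanishes on its tangent
  vectors, i.e.\ iff \<open>B\<close> (resp.\ \<open>A\<close>) vanishes along the divisor.  As a least fixed point, the
  predicate says that the process stops above the given germ and that all components of the
  exceptional divisor are invariant.\<close>

inductive non_dicritical :: "(complex2 \<Rightarrow> complex) \<Rightarrow> (complex2 \<Rightarrow> complex) \<Rightarrow> bool" where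
  regular: "\<not> singular_germ P Q \<Longrightarrow> non_dicritical P Q"
| reduced: "reduced_singularity P Q \<Longrightarrow> non_dicritical P Q"
| blow_up:
  "singular_germ P Q \<Longrightarrow> \<not> reduced_singularity P Q \<Longrightarrow>
   \<forall>t. \<exists>A B. transform_at t P Q A B \<and> (\<forall>\<^sub>F s in nhds 0. B (0, s) = 0) \<and> non_dicritical A B \<Longrightarrow>
   \<exists>A B. transform_at_infinity P Q A B \<and> (\<forall>\<^sub>F s in nhds 0. A (s, 0) = 0) \<and> non_dicritical A B \<Longrightarrow>
   non_dicritical P Q"


section \<open>Leaves\<close>

definition holomorphic_disc :: "(complex \<Rightarrow> complex2) \<Rightarrow> complex2 set \<Rightarrow> bool" where
  "holomorphic_disc \<gamma> M \<longleftrightarrow>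
     (fst \<circ> \<gamma>) holomorphic_on ball 0 1 \<and> (snd \<circ> \<gamma>) holomorphic_on ball 0 1 \<and> \<gamma> ` ball 0 1 \<subseteq> M"

text \<open>The pull-back of \<open>P dx - Q dy\<close> by the disc is zero.\<close>

definition tangent_disc ::
  "(complex2 \<Rightarrow> complex) \<Rightarrow> (complex2 \<Rightarrow> complex) \<Rightarrow> (complex \<Rightarrow> complex2) \<Rightarrow> bool" where
  "tangent_disc P Q \<gamma> \<longleftrightarrow>
     (\<forall>\<zeta>\<in>ball 0 1. P (\<gamma> \<zeta>) * deriv (fst \<circ> \<gamma>) \<zeta> - Q (\<gamma> \<zeta>) * deriv (snd \<circ> \<gamma>) \<zeta> = 0)"

definition regular_points ::
  "(complex2 \<Rightarrow> complex) \<Rightarrow> (complex2 \<Rightarrow> complex) \<Rightarrow> complex2 set \<Rightarrow> complex2 set" where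
  "regular_points P Q W = {z \<in> W. \<not> (P z = 0 \<and> Q z = 0)}"

text \<open>The leaf topology on the regular part of an open set \<open>W\<close>: the finest topology for which all
  holomorphic discs tangent to the foliation are continuous.  Its restriction to a plaque is the
  usual topology, and distinct plaques of a foliated chart are open and disjoint.\<close>

definition leaf_topology ::
  "(complex2 \<Rightarrow> complex) \<Rightarrow> (complex2 \<Rightarrow> complex) \<Rightarrow> complex2 set \<Rightarrow> complex2 topology" where
  "leaf_topology P Q W = topology (\<lambda>A. A \<subseteq> regular_points P Q W \<and>
     (\<forall>\<gamma>. holomorphic_disc \<gamma> (regular_points P Q W) \<and> tangent_disc P Q \<gamma>
        \<longrightarrow> open {\<zeta> \<in> ball 0 1. \<gamma> \<zeta> \<in> A}))"

lemma openin_leaf_topology: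
  "openin (leaf_topology P Q W) A \<longleftrightarrow> A \<subseteq> regular_points P Q W \<and>
     (\<forall>\<gamma>. holomorphic_disc \<gamma> (regular_points P Q W) \<and> tangent_disc P Q \<gamma>
        \<longrightarrow> open {\<zeta> \<in> ball 0 1. \<gamma> \<zeta> \<in> A})"
proof -
  have "istopology (\<lambda>A. A \<subseteq> regular_points P Q W \<and>
     (\<forall>\<gamma>. holomorphic_disc \<gamma> (regular_points P Q W) \<and> tangent_disc P Q \<gamma>
        \<longrightarrow> open {\<zeta> \<in> ball 0 1. \<gamma> \<zeta> \<in> A}))"
    unfolding istopology_def
  proof (intro conjI allI impI)
    fix S T \<gamma>
    assume S: "S \<subseteq> regular_points P Q W \<and>
      (\<forall>\<gamma>. holomorphic_disc \<gamma> (regular_points P Q W) \<and> tangent_disc P Q \<gamma>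
        \<longrightarrow> open {\<zeta> \<in> ball 0 1. \<gamma> \<zeta> \<in> S})"
      and T: "T \<subseteq> regular_points P Q W \<and>
      (\<forall>\<gamma>. holomorphic_disc \<gamma> (regular_points P Q W) \<and> tangent_disc P Q \<gamma>
        \<longrightarrow> open {\<zeta> \<in> ball 0 1. \<gamma> \<zeta> \<in> T})"
    show "S \<inter> T \<subseteq> regular_points P Q W" using S by blast
    assume \<gamma>: "holomorphic_disc \<gamma> (regular_points P Q W) \<and> tangent_disc P Q \<gamma>"
    have "{\<zeta> \<in> ball 0 1. \<gamma> \<zeta> \<in> S \<inter> T} = {\<zeta> \<in> ball 0 1. \<gamma> \<zeta> \<in> S} \<inter> {\<zeta> \<in> ball 0 1. \<gamma> \<zeta> \<in> T}"
      by blast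
    then show "open {\<zeta> \<in> ball 0 1. \<gamma> \<zeta> \<in> S \<inter> T}" using S T \<gamma> by (simp add: open_Int)
  next
    fix K \<gamma>
    assume K: "\<forall>S\<in>K. S \<subseteq> regular_points P Q W \<and>
      (\<forall>\<gamma>. holomorphic_disc \<gamma> (regular_points P Q W) \<and> tangent_disc P Q \<gamma>
        \<longrightarrow> open {\<zeta> \<in> ball 0 1. \<gamma> \<zeta> \<in> S})"
    show "\<Union>K \<subseteq> regular_points P Q W" using K by blast
    assume \<gamma>: "holomorphic_disc \<gamma> (regular_points P Q W) \<and> tangent_disc P Q \<gamma>"
    have "{\<zeta> \<in> ball 0 1. \<gamma> \<zeta> \<in> \<Union>K} = (\<Union>S\<in>K. {\<zeta> \<in> ball 0 1. \<gamma> \<zeta> \<in> S})"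
      by blast
    then show "open {\<zeta> \<in> ball 0 1. \<gamma> \<zeta> \<in> \<Union>K}" using K \<gamma> by auto
  qed
  then show ?thesis
    by (simp add: leaf_topology_def topology_inverse')
qed

lemma topspace_leaf_topology: "topspace (leaf_topology P Q W) = regular_points P Q W"
proof -
  have "{\<zeta> \<in> ball 0 1. \<gamma> \<zeta> \<in> regular_points P Q W} = ball 0 1"
    if "holomorphic_disc \<gamma> (regular_points P Q W)" for \<gamma>
    using that by (auto simp: holomorphic_disc_def)
  then have "openin (leaf_topology P Q W) (regular_points P Q W)"
    by (simp add: openin_leaf_topology)
  then show ?thesis
    by (meson openin_leaf_topology openin_subset openin_topspace subset_antisym)
qed

text \<open>The leaves of the restriction of the foliation to a subset \<open>X\<close> of the regular part.\<close>

definition leaves ::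
  "(complex2 \<Rightarrow> complex) \<Rightarrow> (complex2 \<Rightarrow> complex) \<Rightarrow> complex2 set \<Rightarrow> complex2 set \<Rightarrow>
   complex2 set set" where
  "leaves P Q W X = path_components_of (subtopology (leaf_topology P Q W) X)"


section \<open>Fundamental groups\<close>

definition loops_at :: "'a::topological_space topology \<Rightarrow> 'a \<Rightarrow> (real \<Rightarrow> 'a) set" where
  "loops_at X p = {\<gamma>. pathin X \<gamma> \<and> pathstart \<gamma> = p \<and> pathfinish \<gamma> = p}"

definition loop_class :: "'a::topological_space topology \<Rightarrow> 'a \<Rightarrow> (real \<Rightarrow> 'a) \<Rightarrow> (real \<Rightarrow> 'a) set"
  where
  "loop_class X p \<gamma> = {\<delta>. homotopic_with (\<lambda>h. pathstart h = p \<and> pathfinish h = p)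
                            (top_of_set {0..1}) X \<gamma> \<delta>}"

definition fundamental_group ::
  "'a::topological_space topology \<Rightarrow> 'a \<Rightarrow> (real \<Rightarrow> 'a) set monoid" where
  "fundamental_group X p =
     \<lparr>carrier = loop_class X p ` loops_at X p,
      monoid.mult = (\<lambda>A B. \<Union>\<gamma>\<in>A. \<Union>\<delta>\<in>B. loop_class X p (\<gamma> +++ \<delta>)),
      one = loop_class X p (\<lambda>_. p)\<rparr>"

text \<open>The morphism \<open>\<pi>\<^sub>1(X, p) \<rightarrow> \<pi>\<^sub>1(Y, p)\<close> induced by a continuous inclusion of \<open>X\<close> in \<open>Y\<close>: a loop
  in \<open>X\<close> is sent to the class of the same loop in \<open>Y\<close>.\<close>

definition inclusion_pi1 ::
  "'a::topological_space topology \<Rightarrow> 'a \<Rightarrow> (real \<Rightarrow> 'a) set \<Rightarrow> (real \<Rightarrow> 'a) set" where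
  "inclusion_pi1 Y p A = (\<Union>\<gamma>\<in>A. loop_class Y p \<gamma>)"


section \<open>Milnor tubes and incompressibility\<close>

definition zero_curve :: "(complex2 \<Rightarrow> complex) \<Rightarrow> real \<Rightarrow> complex2 set" where
  "zero_curve f r = {z \<in> cball 0 r. f z = 0}"

definition tube :: "(complex2 \<Rightarrow> complex) \<Rightarrow> real \<Rightarrow> real \<Rightarrow> complex2 set" where
  "tube f r \<eta> = {z \<in> cball 0 r. norm (f z) < \<eta>}"

text \<open>The level curve of \<open>g\<close> through \<open>z\<close> is smooth at \<open>z\<close>, and transverse there to the sphere
  centred at the origin: its tangent line is spanned by \<open>(pd2 g z, - pd1 g z)\<close>, and being a complex
  line, it lies in the tangent space of the sphere iff it is Hermitian-orthogonal to \<open>z\<close>.\<close>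

definition transverse_to_sphere :: "(complex2 \<Rightarrow> complex) \<Rightarrow> complex2 \<Rightarrow> bool" where
  "transverse_to_sphere g z \<longleftrightarrow> pd2 g z * cnj (fst z) - pd1 g z * cnj (snd z) \<noteq> 0"

text \<open>The condition \<open>0 < \<eta> \<lless> r \<lless> 1\<close> on Milnor tubes.  Milnor ball: off the origin, the curve
  \<open>{f = 0}\<close> is smooth and transverse to all spheres of radius at most \<open>r\<close> (\<open>g\<close> is a local reduced
  equation, as \<open>f\<close> need not be reduced); hence the curve is a cone over its trace on the boundary
  sphere, and all its components go through the origin.  Milnor tube: the other fibres over the
  disc of radius \<open>\<eta>\<close> are smooth and transverse to the boundary sphere, so that \<open>f\<close> is a locally
  trivial fibration over the punctured disc.\<close>

definition milnor_ball :: "(complex2 \<Rightarrow> complex) \<Rightarrow> real \<Rightarrow> bool" where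
  "milnor_ball f r \<longleftrightarrow> 0 < r \<and> f 0 = 0 \<and>
     (\<forall>z\<in>zero_curve f r - {0}. \<exists>g N. z \<in> N \<and> g holomorphic2_on N \<and>
        (\<forall>w\<in>N. f w = 0 \<longleftrightarrow> g w = 0) \<and> transverse_to_sphere g z)"

definition milnor_radius :: "(complex2 \<Rightarrow> complex) \<Rightarrow> real \<Rightarrow> real \<Rightarrow> bool" where
  "milnor_radius f r \<eta> \<longleftrightarrow> milnor_ball f r \<and> 0 < \<eta> \<and>
     (\<forall>z\<in>tube f r \<eta> - zero_curve f r. \<not> (pd1 f z = 0 \<and> pd2 f z = 0)) \<and>
     (\<forall>z\<in>tube f r \<eta> - zero_curve f r. norm z = r \<longrightarrow> transverse_to_sphere f z)"

definition invariant_curve ::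
  "(complex2 \<Rightarrow> complex) \<Rightarrow> (complex2 \<Rightarrow> complex) \<Rightarrow> complex2 set \<Rightarrow> bool" where
  "invariant_curve P Q S \<longleftrightarrow> (\<forall>\<gamma>. holomorphic_disc \<gamma> S \<longrightarrow> tangent_disc P Q \<gamma>)"

text \<open>Incompressibility in the closed ball of radius \<open>r\<close>; \<open>W\<close> is an open neighbourhood of the ball
  on which everything is holomorphic.  The set \<open>U\<close> is not required to be open: it contains
  thin tubes, which reach the boundary of the ball.  Fundamental groups are taken at all base
  points, and those of leaves with respect to the leaf topology.\<close>

definition incompressible_in_ball ::
  "(complex2 \<Rightarrow> complex) \<Rightarrow> (complex2 \<Rightarrow> complex) \<Rightarrow> real \<Rightarrow> bool" where
  "incompressible_in_ball P Q r \<longleftrightarrow>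
     (\<exists>W f \<eta>0 U.
        cball 0 r \<subseteq> W \<and> P holomorphic2_on W \<and> Q holomorphic2_on W \<and> f holomorphic2_on W \<and>
        cball 0 r - {0} \<subseteq> regular_points P Q W \<and>
        invariant_curve P Q (zero_curve f r) \<and>
        milnor_radius f r \<eta>0 \<and>
        0 \<in> interior U \<and>
        (let S = zero_curve f r; T = tube f r \<eta>0 in
           U \<subseteq> T \<and>
           (\<forall>p \<in> U - S. inclusion_pi1 (top_of_set (T - S)) p
              \<in> iso (fundamental_group (top_of_set (U - S)) p)
                     (fundamental_group (top_of_set (T - S)) p)) \<and>
           (\<exists>\<eta>1>0. \<forall>\<eta>. 0 < \<eta> \<and> \<eta> < \<eta>1 \<longrightarrow> tube f r \<eta> \<subseteq> U) \<and>
           (\<forall>L \<in> leaves P Q W (U - S). \<forall>p\<in>L.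
              inj_on (inclusion_pi1 (top_of_set (U - S)) p)
                (carrier (fundamental_group (subtopology (leaf_topology P Q W) L) p)))))"

text \<open>Balls of sufficiently small radius: a germ is incompressible if the above data exist in
  arbitrarily small balls, so it is compressible if they exist in no sufficiently small ball.\<close>

definition incompressible :: "(complex2 \<Rightarrow> complex) \<Rightarrow> (complex2 \<Rightarrow> complex) \<Rightarrow> bool" where
  "incompressible P Q \<longleftrightarrow> (\<exists>\<^sub>F r in at_right 0. incompressible_in_ball P Q r)"

abbreviation compressible :: "(complex2 \<Rightarrow> complex) \<Rightarrow> (complex2 \<Rightarrow> complex) \<Rightarrow> bool" where
  "compressible P Q \<equiv> \<not> incompressible P Q"

end

theory Submission
  imports Defs
begin

text \<open>
  The example is \<open>(y (x + y) - x\<^sup>2 y) dx + x\<^sup>3 dy\<close>.  After one blow-up it has two saddle-nodes and one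
  nondegenerate saddle of eigenvalue ratio \<open>-1\<close>, and the exceptional divisor is invariant.  It has
  the first integral \<open>(x + y) e\<^bsup>1/x\<^esup> / y\<close>, so that off the separatrices \<open>x y (x + y) = 0\<close> its leaves are the
  graphs \<open>y = x / (e\<^bsup>c - 1/x\<^esup> - 1)\<close>.

  In the coordinate \<open>\<zeta> = 1/x\<close>, such a leaf in a small ball is contained in \<open>\<complex> - {0}\<close> minus the poles
  \<open>\<zeta> = c + 2 \<pi> i n\<close>.  The commutator of a loop around \<open>0\<close> and a loop around the pole \<open>c\<close> is not null
  homotopic in \<open>\<complex> - {0, c}\<close>, hence not in the leaf.  However it becomes null homotopic in the complement
  of the three separatrices, even in an arbitrarily small ball: there \<open>x\<close> and \<open>y/x\<close> are independent,
  and the loop is contractible both in \<open>\<complex> - {0}\<close> (the values of \<open>1/x\<close>) and in the complement of the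
  poles (which governs \<open>y/x\<close>).  Since every \<open>U\<close> contains a small ball, the leaves are not incompressible in it, once it is known that near the origin every invariant curve \<open>S\<close> is contained in the
  three separatrices.
\<close>

section \<open>Holomorphic functions of two variables\<close>

text \<open>The term -x^2 y of P makes the variables separate: in the chart y = t x the pulled-back
  form is x^2 (t (1 + t) dx + x^2 dt). A leaf ties t to 1/x, while off the separatrices x and t vary
  independently. A commutator detects the difference: in the factor of x, homotopically a circle,
  every commutator dies, and in the factor of t the loop around 0 contracts inside a disc free of
  poles.

  The topology of a leaf in an unknown U is never determined. The leaf is only placed between two
  continuous maps: \<open>leaf_graph c\<close> into it, and 1/x from it to the plane without 0 and
  c. In that plane a commutator has winding number 0 about both points, so the winding number has to
  be taken in a covering. Under exp the loop lifts to a closed path winding -1 times about one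
  logarithm of c; this is why the loop is built in the coordinate log \<zeta> from the start.

  The leaf is not fixed in advance: the smaller the ball, the larger the pole c that is
  used.\<close>

lemma holomorphic2_on_slices:
  assumes "(f has_derivative (\<lambda>v. a * fst v + b * snd v)) (at z)"
  shows "((\<lambda>x. f (x, snd z)) has_field_derivative a) (at (fst z))"
    and "((\<lambda>y. f (fst z, y)) has_field_derivative b) (at (snd z))"
proof -
  have *: "(f has_derivative (\<lambda>v. a * fst v + b * snd v)) (at (fst z, snd z))"
    using assms by simp
  have "((\<lambda>x. (x, snd z)) has_derivative (\<lambda>h. (h, 0))) (at (fst z))"
    by (auto intro!: derivative_eq_intros)
  from has_derivative_compose[OF this *]
  show "((\<lambda>x. f (x, snd z)) has_field_derivative a) (at (fst z))"
    by (simp add: has_field_derivative_def)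
  have "((\<lambda>y. (fst z, y)) has_derivative (\<lambda>h. (0, h))) (at (snd z))"
    by (auto intro!: derivative_eq_intros)
  from has_derivative_compose[OF this *]
  show "((\<lambda>y. f (fst z, y)) has_field_derivative b) (at (snd z))"
    by (simp add: has_field_derivative_def)
qed

lemma pd_eqI:
  assumes "(f has_derivative (\<lambda>v. a * fst v + b * snd v)) (at z)"
  shows "pd1 f z = a" "pd2 f z = b"
  using holomorphic2_on_slices[OF assms] by (simp_all add: pd1_def pd2_def DERIV_imp_deriv)

lemma holomorphic2_on_has_derivative:
  assumes "f holomorphic2_on U" "z \<in> U"
  shows "(f has_derivative (\<lambda>v. pd1 f z * fst v + pd2 f z * snd v)) (at z)"
proof -
  obtain a b where "(f has_derivative (\<lambda>v. a * fst v + b * snd v)) (at z)"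
    using assms unfolding holomorphic2_on_def by blast
  then show ?thesis using pd_eqI by simp
qed

lemma holomorphic2_on_continuous_on: "f holomorphic2_on U \<Longrightarrow> continuous_on U f"
  by (intro continuous_at_imp_continuous_on ballI has_derivative_continuous)
     (rule holomorphic2_on_has_derivative)

lemma holomorphic2_on_chain:
  assumes "f holomorphic2_on U" "(X \<zeta>, Y \<zeta>) \<in> U"
    and X: "(X has_field_derivative X') (at \<zeta>)" and Y: "(Y has_field_derivative Y') (at \<zeta>)"
  shows "((\<lambda>\<zeta>. f (X \<zeta>, Y \<zeta>)) has_field_derivative
           pd1 f (X \<zeta>, Y \<zeta>) * X' + pd2 f (X \<zeta>, Y \<zeta>) * Y') (at \<zeta>)"
proof -
  have "((\<lambda>\<zeta>. (X \<zeta>, Y \<zeta>)) has_derivative (\<lambda>h. (X' * h, Y' * h))) (at \<zeta>)"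
    using X Y unfolding has_field_derivative_def by (rule has_derivative_Pair)
  from has_derivative_compose[OF this holomorphic2_on_has_derivative[OF assms(1,2)]]
  show ?thesis
    unfolding has_field_derivative_def
    by (rule has_derivative_eq_rhs) (simp add: fun_eq_iff algebra_simps)
qed

lemma holomorphic2_on_compose:
  assumes "f holomorphic2_on U" "\<And>\<zeta>. \<zeta> \<in> D \<Longrightarrow> (X \<zeta>, Y \<zeta>) \<in> U"
    and "X holomorphic_on D" "Y holomorphic_on D" "open D"
  shows "(\<lambda>\<zeta>. f (X \<zeta>, Y \<zeta>)) holomorphic_on D"
  using holomorphic2_on_chain[OF assms(1,2) holomorphic_derivI[OF assms(3,5)] holomorphic_derivI[OF assms(4,5)]]
  unfolding holomorphic_on_open[OF assms(5)] by blast

section \<open>Closure properties of holomorphic functions of two variables\<close>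

lemma holomorphic2_on_subset:
  "f holomorphic2_on U \<Longrightarrow> open V \<Longrightarrow> V \<subseteq> U \<Longrightarrow> f holomorphic2_on V"
  unfolding holomorphic2_on_def by blast

lemma holomorphic2_on_const: "open U \<Longrightarrow> (\<lambda>z. c) holomorphic2_on U"
  unfolding holomorphic2_on_def by (auto intro!: exI[of _ 0])

lemma holomorphic2_on_fst: "open U \<Longrightarrow> fst holomorphic2_on U"
  unfolding holomorphic2_on_def
  by (intro conjI ballI exI[of _ 1] exI[of _ "0::complex"])
     (simp_all add: bounded_linear_fst bounded_linear_imp_has_derivative)

lemma holomorphic2_on_snd: "open U \<Longrightarrow> snd holomorphic2_on U"
  unfolding holomorphic2_on_def
  by (intro conjI ballI exI[of _ "0::complex"] exI[of _ 1])
     (simp_all add: bounded_linear_snd bounded_linear_imp_has_derivative)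

lemma holomorphic2_on_mult:
  assumes "f holomorphic2_on U" "g holomorphic2_on U"
  shows "(\<lambda>z. f z * g z) holomorphic2_on U"
  unfolding holomorphic2_on_def
proof (intro conjI ballI)
  show "open U" using assms holomorphic2_on_def by blast
  fix z assume "z \<in> U"
  then obtain a b c d where "(f has_derivative (\<lambda>v. a * fst v + b * snd v)) (at z)"
      "(g has_derivative (\<lambda>v. c * fst v + d * snd v)) (at z)"
    using assms unfolding holomorphic2_on_def by meson
  from has_derivative_mult[OF this] show "\<exists>a b. ((\<lambda>z. f z * g z) has_derivative (\<lambda>v. a * fst v + b * snd v)) (at z)"
    by (intro exI[of _ "f z * c + a * g z"] exI[of _ "f z * d + b * g z"])
       (auto elim!: has_derivative_eq_rhs simp: algebra_simps)
qed

lemma holomorphic2_on_add: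
  assumes "f holomorphic2_on U" "g holomorphic2_on U"
  shows "(\<lambda>z. f z + g z) holomorphic2_on U"
  unfolding holomorphic2_on_def
proof (intro conjI ballI)
  show "open U" using assms holomorphic2_on_def by blast
  fix z assume "z \<in> U"
  then obtain a b c d where "(f has_derivative (\<lambda>v. a * fst v + b * snd v)) (at z)"
      "(g has_derivative (\<lambda>v. c * fst v + d * snd v)) (at z)"
    using assms unfolding holomorphic2_on_def by meson
  from has_derivative_add[OF this] show "\<exists>a b. ((\<lambda>z. f z + g z) has_derivative (\<lambda>v. a * fst v + b * snd v)) (at z)"
    by (intro exI[of _ "a + c"] exI[of _ "b + d"])
       (auto elim!: has_derivative_eq_rhs simp: algebra_simps)
qed

lemma holomorphic2_on_uminus: "f holomorphic2_on U \<Longrightarrow> (\<lambda>z. - f z) holomorphic2_on U"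
  using holomorphic2_on_mult[OF holomorphic2_on_const[of U "-1"], of f] by (simp add: holomorphic2_on_def)

lemma holomorphic2_on_diff:
  "f holomorphic2_on U \<Longrightarrow> g holomorphic2_on U \<Longrightarrow> (\<lambda>z. f z - g z) holomorphic2_on U"
  using holomorphic2_on_add[OF _ holomorphic2_on_uminus, of f U g] by simp

lemma holomorphic2_on_power:
  "f holomorphic2_on U \<Longrightarrow> (\<lambda>z. f z ^ n) holomorphic2_on U"
proof (induction n)
  case 0
  then show ?case by (simp add: holomorphic2_on_const holomorphic2_on_def[of f])
next
  case (Suc n)
  then show ?case unfolding power_Suc by (intro holomorphic2_on_mult)
qed

lemma holomorphic_germI: "f holomorphic2_on UNIV \<Longrightarrow> holomorphic_germ f"
  unfolding holomorphic_germ_def by blast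

text \<open>Cauchy's inequality on small discs in the direction \<open>v\<close> turns uniform continuity of \<open>f\<close> into
  continuity of its directional derivative.\<close>

lemma continuous_on_directional_derivative:
  assumes f: "f holomorphic2_on U" and v: "norm (fst v) + norm (snd v) \<le> 1"
  shows "continuous_on U (\<lambda>z. pd1 f z * fst v + pd2 f z * snd v)"
  unfolding continuous_on_eq_continuous_at[OF holomorphic2_on_def[THEN iffD1, OF f, THEN conjunct1]]
proof
  fix z0 assume "z0 \<in> U"
  have oU: "open U" using f holomorphic2_on_def by blast
  then obtain s where s: "s > 0" "cball z0 s \<subseteq> U" using \<open>z0 \<in> U\<close> open_contains_cball by blast
  \<comment> \<open>Half of \<open>s\<close>: a disc of radius \<open>r\<close> around a centre at
    distance at most \<open>r\<close> from \<open>z0\<close> stays in the ball of radius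
    \<open>s\<close>.\<close>
  define r where "r = s / 2"
  have r: "r > 0" using s by (simp add: r_def)
  have cont: "continuous_on (cball z0 s) f"
    using holomorphic2_on_continuous_on[OF f] s(2) by (rule continuous_on_subset)
  have uc: "uniformly_continuous_on (cball z0 s) f"
    by (rule compact_uniformly_continuous[OF cont compact_cball])
  define l :: "complex2 \<Rightarrow> complex \<Rightarrow> complex2" where "l z t = (fst z + t * fst v, snd z + t * snd v)" for z t
  have lz: "l z t - z = (t * fst v, t * snd v)" for z t by (simp add: l_def prod_eq_iff)
  have l_dist: "norm (l z t - z) \<le> norm t" for z t
  proof -
    have "norm (l z t - z) \<le> norm (t * fst v) + norm (t * snd v)" unfolding lz by (rule norm_Pair_le)
    also have "\<dots> = norm t * (norm (fst v) + norm (snd v))" by (simp add: norm_mult distrib_left)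
    also have "\<dots> \<le> norm t * 1" using v by (intro mult_left_mono) auto
    finally show ?thesis by simp
  qed
  have l_in: "l z t \<in> cball z0 s" if "dist z0 z \<le> r" "norm t \<le> r" for z t
  proof -
    have "dist z0 (l z t) \<le> dist z0 z + dist z (l z t)" by (rule dist_triangle)
    also have "\<dots> \<le> r + r" using that l_dist[of z t] by (intro add_mono) (auto simp: dist_norm norm_minus_commute)
    finally show ?thesis by (simp add: r_def)
  qed
  have D: "((\<lambda>t. f (l z t)) has_field_derivative
      pd1 f (l z t) * fst v + pd2 f (l z t) * snd v) (at t)" if "dist z0 z \<le> r" "norm t \<le> r" for z t
    unfolding l_def
    by (rule holomorphic2_on_chain[OF f])
       (use l_in[OF that] s(2) in \<open>auto simp: l_def intro!: derivative_eq_intros\<close>)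
  have l0: "l z 0 = z" for z by (simp add: l_def)
  show "isCont (\<lambda>z. pd1 f z * fst v + pd2 f z * snd v) z0"
    unfolding isCont_def LIM_eq
  proof (intro allI impI)
    fix e :: real assume e: "e > 0"
    \<comment> \<open>Cauchy's inequality on a disc of radius \<open>r\<close> divides by
      \<open>r\<close>, so the bound e r / 2 on the increment becomes e / 2 for the
      derivative.\<close>
    obtain d where d: "d > 0" "\<And>x x'. x \<in> cball z0 s \<Longrightarrow> x' \<in> cball z0 s \<Longrightarrow> dist x' x < d \<Longrightarrow> dist (f x') (f x) < e * r / 2"
      using uc e r unfolding uniformly_continuous_on_def
      by (metis divide_pos_pos mult_pos_pos zero_less_numeral)
    show "\<exists>k>0. \<forall>z. z \<noteq> z0 \<and> norm (z - z0) < k \<longrightarrow>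
        norm (pd1 f z * fst v + pd2 f z * snd v - (pd1 f z0 * fst v + pd2 f z0 * snd v)) < e"
    proof (intro exI[of _ "min d r"] conjI allI impI)
      show "min d r > 0" using d r by simp
      fix z assume z: "z \<noteq> z0 \<and> norm (z - z0) < min d r"
      then have zr: "dist z0 z \<le> r" "dist z0 z0 \<le> r" using r by (auto simp: dist_norm norm_minus_commute)
      define \<psi> where "\<psi> t = f (l z t) - f (l z0 t)" for t
      have D\<psi>: "(\<psi> has_field_derivative (pd1 f (l z t) * fst v + pd2 f (l z t) * snd v)
          - (pd1 f (l z0 t) * fst v + pd2 f (l z0 t) * snd v)) (at t)" if "norm t \<le> r" for t
        unfolding \<psi>_def[abs_def] by (intro DERIV_diff D zr that)
      have "norm ((deriv ^^ 1) \<psi> 0) \<le> fact 1 * (e * r / 2) / r ^ 1"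
      proof (rule Cauchy_inequality)
        have "\<psi> field_differentiable at t" if "norm t \<le> r" for t
          using D\<psi>[OF that] field_differentiable_def by blast
        then show "\<psi> holomorphic_on ball 0 r" "continuous_on (cball 0 r) \<psi>"
          by (auto simp: holomorphic_on_def field_differentiable_at_within
              intro!: continuous_at_imp_continuous_on field_differentiable_imp_continuous_at)
        fix t :: complex assume "norm (0 - t) = r"
        then have t: "norm t \<le> r" by simp
        have "dist (l z t) (l z0 t) = norm (z - z0)"
          by (simp add: l_def dist_norm norm_Pair) (simp add: norm_prod_def)
        then have "dist (f (l z t)) (f (l z0 t)) < e * r / 2"
          using z by (intro d(2) l_in zr t) auto
        then show "norm (\<psi> t) \<le> e * r / 2" by (simp add: \<psi>_def dist_norm)
      qed (use r in auto)
      moreover have "deriv \<psi> 0 = (pd1 f z * fst v + pd2 f z * snd v) - (pd1 f z0 * fst v + pd2 f z0 * snd v)"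
        using DERIV_imp_deriv[OF D\<psi>[of 0]] r by (simp add: l0)
      ultimately show "norm (pd1 f z * fst v + pd2 f z * snd v - (pd1 f z0 * fst v + pd2 f z0 * snd v)) < e"
        using e r by simp
    qed
  qed
qed

text \<open>\<open>holomorphic2_on\<close> asks for a derivative at each point only; the inverse
  function theorem behind \<open>zero_curve_chart\<close> needs it to be continuous.\<close>

lemma continuous_on_pd:
  assumes "f holomorphic2_on U"
  shows "continuous_on U (pd1 f)" "continuous_on U (pd2 f)"
  using continuous_on_directional_derivative[OF assms, of "(1, 0)"]
    continuous_on_directional_derivative[OF assms, of "(0, 1)"] by simp_all

text \<open>The implicit function theorem, applied to \<open>g\<close> together with the linear form
  \<open>(x, y) \<mapsto> - cnj (\<partial>\<^sub>2 g) x + cnj (\<partial>\<^sub>1 g) y\<close>, which is independent of \<open>dg\<close> at the point considered.\<close>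

lemma zero_curve_chart:
  assumes g: "g holomorphic2_on N" and z: "z \<in> N" "g z = 0" and nz: "\<not> (pd1 g z = 0 \<and> pd2 g z = 0)"
  obtains \<gamma> V where "open V" "z \<in> V" "(fst \<circ> \<gamma>) holomorphic_on ball 0 1" "(snd \<circ> \<gamma>) holomorphic_on ball 0 1"
    "\<gamma> 0 = z" "\<gamma> ` ball 0 1 \<subseteq> {w \<in> N. g w = 0}" "{w \<in> V. g w = 0} \<subseteq> \<gamma> ` ball 0 1"
    "\<not> (deriv (fst \<circ> \<gamma>) 0 = 0 \<and> deriv (snd \<circ> \<gamma>) 0 = 0)"
proof -
  have oN: "open N" using g holomorphic2_on_def by blast
  define a b where "a = pd1 g z" and "b = pd2 g z"
  define D where "D = a * cnj a + b * cnj b"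
  have D: "D \<noteq> 0"
  proof -
    have "D = of_real (norm a ^ 2 + norm b ^ 2)"
      by (simp only: D_def of_real_add complex_norm_square)
    moreover have "norm a ^ 2 + norm b ^ 2 \<noteq> 0"
      using nz by (simp add: a_def b_def sum_power2_eq_zero_iff)
    ultimately show ?thesis by (metis of_real_eq_0_iff)
  qed
  define \<Phi> where "\<Phi> w = (g w, - cnj b * fst w + cnj a * snd w)" for w :: complex2
  define T where "T w v = (pd1 g w * fst v + pd2 g w * snd v, - cnj b * fst v + cnj a * snd v)" for w v :: complex2
  have D\<Phi>: "(\<Phi> has_derivative T w) (at w)" if "w \<in> N" for w
    unfolding \<Phi>_def[abs_def] T_def[abs_def]
    by (intro has_derivative_Pair holomorphic2_on_has_derivative[OF g that])
       (auto intro!: derivative_eq_intros)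
  define \<Phi>' where "\<Phi>' w = Blinfun (T w)" for w
  have apply\<Phi>': "blinfun_apply (\<Phi>' w) = T w" if "w \<in> N" for w
    unfolding \<Phi>'_def using has_derivative_bounded_linear[OF D\<Phi>[OF that]] by (rule bounded_linear_Blinfun_apply)
  \<comment> \<open>The inverse of \<open>T z\<close>: the adjugate of its matrix divided by the
    determinant \<open>D\<close>.\<close>
  define I where "I u = ((cnj a * fst u - b * snd u) / D, (cnj b * fst u + a * snd u) / D)" for u :: complex2
  have "linear I"
    by (rule linearI) (auto simp: I_def algebra_simps add_divide_distrib diff_divide_distrib scaleR_conv_of_real)
  then have applyI: "blinfun_apply (Blinfun I) = I"
    by (intro bounded_linear_Blinfun_apply) (simp add: linear_conv_bounded_linear)
  have IT: "I (T z v) = v" for v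
  proof -
    have "cnj a * (a * fst v + b * snd v) - b * (- cnj b * fst v + cnj a * snd v) = D * fst v"
      "cnj b * (a * fst v + b * snd v) + a * (- cnj b * fst v + cnj a * snd v) = D * snd v"
      by (simp_all add: D_def algebra_simps)
    then show ?thesis using D by (simp add: I_def T_def a_def[symmetric] b_def[symmetric])
  qed
  have contN: "continuous_on N \<Phi>'"
  proof (rule continuous_on_blinfun_componentwise)
    fix i :: complex2
    have "continuous_on N (\<lambda>w. T w i)"
      unfolding T_def by (intro continuous_intros continuous_on_pd[OF g])
    then show "continuous_on N (\<lambda>w. blinfun_apply (\<Phi>' w) i)"
      by (rule continuous_on_eq) (simp add: apply\<Phi>')
  qed
  have inv: "Blinfun I o\<^sub>L \<Phi>' z = id_blinfun"
    by (rule blinfun_eqI) (simp add: applyI apply\<Phi>'[OF z(1)] IT)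
  have D\<Phi>': "(\<Phi> has_derivative blinfun_apply (\<Phi>' w)) (at w)" if "w \<in> N" for w
    using D\<Phi>[OF that] apply\<Phi>'[OF that] by simp
  obtain U' V0 G G' where U': "open U'" "U' \<subseteq> N" "z \<in> U'" and V0: "open V0" "\<Phi> z \<in> V0"
    and hom: "homeomorphism U' V0 \<Phi> G"
    and G: "\<And>y. y \<in> V0 \<Longrightarrow> (G has_derivative G' y) (at y)"
    and G'inv: "\<And>y. y \<in> V0 \<Longrightarrow> G' y = inv_into UNIV (blinfun_apply (\<Phi>' (G y)))"
    and bij: "\<And>y. y \<in> V0 \<Longrightarrow> bij (blinfun_apply (\<Phi>' (G y)))"
    by (rule inverse_function_theorem[OF oN D\<Phi>' contN z(1) inv]) auto
  define q0 where "q0 = snd (\<Phi> z)"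
  have \<Phi>z: "\<Phi> z = (0, q0)" by (simp add: q0_def \<Phi>_def z)
  obtain \<rho> where \<rho>: "\<rho> > 0" "ball (\<Phi> z) \<rho> \<subseteq> V0" using V0 open_contains_ball by blast
  \<comment> \<open>In the coordinates \<open>\<Phi>\<close> the curve is the line where the first
    coordinate vanishes; \<open>s\<close> parametrises a disc of it by the unit disc.\<close>
  define s where "s \<zeta> = ((0::complex), q0 + of_real \<rho> * \<zeta>)" for \<zeta> :: complex
  have s: "s \<zeta> \<in> V0" if "\<zeta> \<in> ball 0 1" for \<zeta>
  proof -
    have "dist (\<Phi> z) (s \<zeta>) = \<rho> * norm \<zeta>"
      unfolding \<Phi>z s_def using \<rho> by (simp add: dist_Pair_Pair dist_norm norm_mult)
    then show ?thesis using that \<rho> by (intro subsetD[OF \<rho>(2)]) simp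
  qed
  define \<gamma> where "\<gamma> \<zeta> = G (s \<zeta>)" for \<zeta>
  have GU: "G y \<in> U'" if "y \<in> V0" for y using hom that unfolding homeomorphism_def by blast
  have \<Phi>G: "\<Phi> (G y) = y" if "y \<in> V0" for y using hom that unfolding homeomorphism_def by blast
  have G\<Phi>: "G (\<Phi> w) = w" if "w \<in> U'" for w using hom that unfolding homeomorphism_def by blast
  have deriv: "\<exists>\<alpha> \<beta>. ((fst \<circ> \<gamma>) has_field_derivative \<alpha>) (at \<zeta>) \<and> ((snd \<circ> \<gamma>) has_field_derivative \<beta>) (at \<zeta>)
      \<and> - cnj b * \<alpha> + cnj a * \<beta> = of_real \<rho>" if "\<zeta> \<in> ball 0 1" for \<zeta>
  proof -
    have y: "s \<zeta> \<in> V0" by (rule s[OF that])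
    have \<gamma>N: "\<gamma> \<zeta> \<in> N" using GU[OF y] U'(2) by (auto simp: \<gamma>_def)
    have bijT: "bij (T (\<gamma> \<zeta>))" using bij[OF y] apply\<Phi>'[OF \<gamma>N] by (simp add: \<gamma>_def)
    have G'T: "G' (s \<zeta>) = inv_into UNIV (T (\<gamma> \<zeta>))" using G'inv[OF y] apply\<Phi>'[OF \<gamma>N] by (simp add: \<gamma>_def)
    \<comment> \<open>\<open>G\<close> comes with a real derivative only. As \<open>T\<close> is
      complex linear, the inverse sends the direction of the line to complex multiples of one vector
      \<open>u\<close>, which makes \<open>\<gamma>\<close> holomorphic.\<close>
    obtain u where u: "T (\<gamma> \<zeta>) u = (0, of_real \<rho>)" using bijT by (metis bij_pointE)
    have Tu: "T (\<gamma> \<zeta>) (fst u * h, snd u * h) = (0, of_real \<rho> * h)" for h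
    proof -
      have "T (\<gamma> \<zeta>) (fst u * h, snd u * h) = (fst (T (\<gamma> \<zeta>) u) * h, snd (T (\<gamma> \<zeta>) u) * h)"
        by (simp add: T_def algebra_simps)
      then show ?thesis by (simp add: u)
    qed
    have inv_u: "inv_into UNIV (T (\<gamma> \<zeta>)) (0, of_real \<rho> * h) = (fst u * h, snd u * h)" for h
      unfolding Tu[symmetric] by (rule inv_f_f[OF bij_is_inj[OF bijT]])
    have "(s has_derivative (\<lambda>h. (0, of_real \<rho> * h))) (at \<zeta>)"
      unfolding s_def[abs_def] by (auto intro!: derivative_eq_intros)
    from has_derivative_compose[OF this G[OF y]]
    have "(\<gamma> has_derivative (\<lambda>h. (fst u * h, snd u * h))) (at \<zeta>)"
      unfolding \<gamma>_def[abs_def] by (simp add: G'T inv_u)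
    from has_derivative_fst[OF this] has_derivative_snd[OF this]
    have "((fst \<circ> \<gamma>) has_field_derivative fst u) (at \<zeta>)" "((snd \<circ> \<gamma>) has_field_derivative snd u) (at \<zeta>)"
      by (simp_all add: has_field_derivative_def o_def)
    moreover have "- cnj b * fst u + cnj a * snd u = of_real \<rho>" using u by (simp add: T_def)
    ultimately show ?thesis by blast
  qed
  show ?thesis
  proof (rule that)
    define V where "V = U' \<inter> \<Phi> -` ball (\<Phi> z) \<rho>"
    have "continuous_on U' \<Phi>" using hom unfolding homeomorphism_def by blast
    then show "open V" unfolding V_def by (rule continuous_open_preimage[OF _ U'(1) open_ball])
    show "z \<in> V" using U'(3) \<rho>(1) by (simp add: V_def)
    show "(fst \<circ> \<gamma>) holomorphic_on ball 0 1" "(snd \<circ> \<gamma>) holomorphic_on ball 0 1"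
      unfolding holomorphic_on_open[OF open_ball] using deriv by blast+
    show "\<gamma> 0 = z" using G\<Phi>[OF U'(3)] by (simp add: \<gamma>_def s_def \<Phi>z)
    show "\<gamma> ` ball 0 1 \<subseteq> {w \<in> N. g w = 0}"
    proof
      fix w assume "w \<in> \<gamma> ` ball 0 1"
      then obtain \<zeta> where \<zeta>: "\<zeta> \<in> ball 0 1" "w = \<gamma> \<zeta>" by blast
      have "w \<in> N" using GU[OF s[OF \<zeta>(1)]] U'(2) by (auto simp: \<gamma>_def \<zeta>)
      moreover have "fst (\<Phi> w) = 0" using \<Phi>G[OF s[OF \<zeta>(1)]] by (simp add: \<gamma>_def \<zeta> s_def)
      ultimately show "w \<in> {w \<in> N. g w = 0}" by (simp add: \<Phi>_def)
    qed
    show "{w \<in> V. g w = 0} \<subseteq> \<gamma> ` ball 0 1"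
    proof
      fix w assume w: "w \<in> {w \<in> V. g w = 0}"
      define q where "q = snd (\<Phi> w)"
      have \<Phi>w: "\<Phi> w = (0, q)" using w by (simp add: \<Phi>_def q_def)
      have "dist (\<Phi> z) (\<Phi> w) < \<rho>" using w by (simp add: V_def)
      then have "dist q0 q < \<rho>" by (simp add: \<Phi>w \<Phi>z dist_Pair_Pair)
      then have "(q - q0) / of_real \<rho> \<in> ball 0 1"
        using \<rho>(1) by (simp add: norm_divide dist_norm norm_minus_commute)
      moreover have "\<gamma> ((q - q0) / of_real \<rho>) = w"
      proof -
        have "s ((q - q0) / of_real \<rho>) = \<Phi> w" using \<rho>(1) by (simp add: s_def \<Phi>w)
        then show ?thesis using G\<Phi>[of w] w by (simp add: \<gamma>_def V_def)
      qed
      ultimately show "w \<in> \<gamma> ` ball 0 1" by (metis imageI)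
    qed
    obtain \<alpha> \<beta> where ab: "((fst \<circ> \<gamma>) has_field_derivative \<alpha>) (at 0)" "((snd \<circ> \<gamma>) has_field_derivative \<beta>) (at 0)"
      "- cnj b * \<alpha> + cnj a * \<beta> = of_real \<rho>" using deriv[of 0] by auto
    show "\<not> (deriv (fst \<circ> \<gamma>) 0 = 0 \<and> deriv (snd \<circ> \<gamma>) 0 = 0)"
      using ab(3) \<rho>(1) unfolding DERIV_imp_deriv[OF ab(1)] DERIV_imp_deriv[OF ab(2)] by auto
  qed
qed

section \<open>The foliation and its reduction\<close>

text \<open>Otherwise the maximum principle, applied to \<open>1 / h(x, \<cdot>)\<close> for small \<open>x \<noteq> 0\<close>, would
  contradict \<open>h(0, 0) = 0\<close>.\<close>

lemma no_isolated_zero: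
  assumes h: "holomorphic_germ h" and nz: "\<forall>\<^sub>F z in nhds 0. z \<noteq> 0 \<longrightarrow> h z \<noteq> 0"
  shows "h 0 \<noteq> 0"
proof
  assume h0: "h 0 = 0"
  obtain U where U: "0 \<in> U" "h holomorphic2_on U"
    using h holomorphic_germ_def by blast
  then have oU: "open U" by (simp add: holomorphic2_on_def)
  obtain V where V: "open V" "0 \<in> V" "\<And>z. z \<in> V \<Longrightarrow> z \<noteq> 0 \<Longrightarrow> h z \<noteq> 0"
    using nz unfolding eventually_nhds by blast
  have "open (U \<inter> V)" "0 \<in> U \<inter> V" using oU U V by auto
  then obtain e where e: "e > 0" "cball 0 e \<subseteq> U \<inter> V"
    by (meson open_contains_cball)
  define d where "d = e / 2"
  have d: "d > 0" using e by (simp add: d_def)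
  have in_e: "(x, y) \<in> U \<inter> V" if "norm x \<le> d" "norm y \<le> d" for x y
  proof -
    have "norm (x, y) \<le> norm x + norm y" by (rule norm_Pair_le)
    then have "norm (x, y) \<le> e" using that by (simp add: d_def)
    then show ?thesis using e by auto
  qed
  have cont: "continuous_on (cball 0 d \<times> cball 0 d) h"
    using holomorphic2_on_continuous_on[OF U(2)] by (rule continuous_on_subset) (use in_e in auto)
  \<comment> \<open>Here y runs over a circle, so \<open>h\<close> has no zero on this compact set
    even at x = 0, and its modulus has a positive minimum.\<close>
  let ?K = "cball 0 d \<times> sphere 0 d :: complex2 set"
  have "continuous_on ?K (\<lambda>z. norm (h z))"
    by (intro continuous_on_norm continuous_on_subset[OF cont]) auto
  moreover have "(0, of_real d) \<in> ?K" using d by auto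
  ultimately obtain z0 where z0: "z0 \<in> ?K" "\<And>z. z \<in> ?K \<Longrightarrow> norm (h z0) \<le> norm (h z)"
    using continuous_attains_inf[of ?K "\<lambda>z. norm (h z)"] by (auto simp: compact_Times)
  define m where "m = norm (h z0)"
  have "z0 \<in> V" "z0 \<noteq> 0" using z0(1) in_e d by (auto simp: zero_prod_def)
  then have m: "m > 0" using V(3) by (simp add: m_def)
  have low: "norm (h (x, 0)) \<ge> m" if x: "x \<noteq> 0" "norm x \<le> d" for x
  proof -
    have nz: "h (x, y) \<noteq> 0" if "norm y \<le> d" for y
      using V(3) in_e[OF x(2) that] x(1) by (auto simp: zero_prod_def)
    have contx: "continuous_on (cball 0 d) (\<lambda>y. inverse (h (x, y)))"
      by (intro continuous_on_inverse continuous_on_compose2[OF cont] continuous_intros)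
         (use x nz in auto)
    have "(\<lambda>y. h (x, y)) holomorphic_on ball 0 d"
      by (rule holomorphic2_on_compose[OF U(2)]) (use x in_e in auto)
    then have hol: "(\<lambda>y. inverse (h (x, y))) holomorphic_on ball 0 d"
      by (intro holomorphic_on_inverse) (use nz in auto)
    have "norm (inverse (h (x, 0))) \<le> inverse m"
    proof (rule maximum_modulus_frontier[where S = "cball 0 d" and \<xi> = 0 and f = "\<lambda>y. inverse (h (x, y))"])
      show "(\<lambda>y. inverse (h (x, y))) holomorphic_on interior (cball 0 d)" using hol by simp
      show "continuous_on (closure (cball 0 d)) (\<lambda>y. inverse (h (x, y)))" using contx by simp
      fix y :: complex assume "y \<in> frontier (cball 0 d)"
      then have "(x, y) \<in> ?K" using x d by auto
      then have "m \<le> norm (h (x, y))" using z0(2) m_def by auto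
      then show "norm (inverse (h (x, y))) \<le> inverse m"
        using m by (simp add: norm_inverse le_imp_inverse_le)
    qed (use d in auto)
    then show ?thesis using m nz[of 0] d by (simp add: norm_inverse)
  qed
  have "((\<lambda>x. norm (h (x, 0))) \<longlongrightarrow> norm (h (0, 0))) (at 0)"
  proof -
    have "continuous_on (ball 0 d) (\<lambda>x. norm (h (x, 0)))"
      by (intro continuous_intros continuous_on_compose2[OF cont]) (use d in auto)
    then show ?thesis using d by (simp add: continuous_on_eq_continuous_at isCont_def)
  qed
  moreover have "\<forall>\<^sub>F x in at 0. m \<le> norm (h (x, 0))"
    using low d unfolding eventually_at by (intro exI[of _ d]) auto
  ultimately have "m \<le> norm (h (0, 0))"
    by (rule tendsto_lowerbound) simp
  then show False using h0 m by (simp add: zero_prod_def)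
qed

text \<open>A common factor can vanish only where both functions do, that is, at the origin alone;
  by \<open>no_isolated_zero\<close> it then does not vanish there either.\<close>

lemma coprime_germsI:
  assumes "\<forall>\<^sub>F z in nhds 0. z \<noteq> 0 \<longrightarrow> P z \<noteq> 0 \<or> Q z \<noteq> 0"
  shows "coprime_germs P Q"
  unfolding coprime_germs_def
proof (intro allI impI, elim conjE)
  fix h p q assume h: "holomorphic_germ h"
    and "\<forall>\<^sub>F z in nhds 0. P z = h z * p z \<and> Q z = h z * q z"
  with assms have "\<forall>\<^sub>F z in nhds 0. z \<noteq> 0 \<longrightarrow> h z \<noteq> 0"
    by eventually_elim auto
  then show "h 0 \<noteq> 0" using no_isolated_zero[OF h] by blast
qed

definition germ_P :: "complex2 \<Rightarrow> complex" where
  "germ_P z = snd z * (fst z + snd z) - fst z ^ 2 * snd z"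

definition germ_Q :: "complex2 \<Rightarrow> complex" where
  "germ_Q z = - (fst z ^ 3)"

lemma germ_holomorphic: "open W \<Longrightarrow> germ_P holomorphic2_on W" "open W \<Longrightarrow> germ_Q holomorphic2_on W"
  unfolding germ_P_def[abs_def] germ_Q_def[abs_def] by (intro holomorphic2_on_mult holomorphic2_on_add
    holomorphic2_on_diff holomorphic2_on_power holomorphic2_on_uminus holomorphic2_on_fst holomorphic2_on_snd; assumption)+

lemma germ_common_zero: "germ_P z = 0 \<and> germ_Q z = 0 \<longleftrightarrow> z = 0"
  by (cases z) (auto simp: germ_P_def germ_Q_def zero_prod_def)

lemma germ_foliation: "foliation_germ germ_P germ_Q"
  unfolding foliation_germ_def using germ_common_zero
  by (intro conjI holomorphic_germI germ_holomorphic coprime_germsI always_eventually) auto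

lemma germ_singular: "singular_germ germ_P germ_Q"
  by (simp add: singular_germ_def germ_P_def germ_Q_def)

text \<open>The alternative \<open>c = 0\<close> spares a case distinction: the parameters inserted
  for \<open>c\<close> here and in the companion for \<open>snd\<close>, such as -t and -1 - t, may
  themselves be 0.\<close>

lemma eventually_fst_near_0: "\<forall>\<^sub>F z in nhds (0 :: complex2). fst z \<noteq> c \<or> c = 0"
proof (cases "c = 0")
  case False
  have "((fst :: complex2 \<Rightarrow> complex) \<longlongrightarrow> fst (0::complex2)) (nhds 0)"
    by (intro tendsto_intros filterlim_ident)
  then show ?thesis using False
    by (metis (mono_tags, lifting) eventually_mono fst_zero tendsto_imp_eventually_ne)
qed auto

lemma eventually_snd_near_0: "\<forall>\<^sub>F z in nhds (0 :: complex2). snd z \<noteq> c \<or> c = 0"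
proof (cases "c = 0")
  case False
  have "((snd :: complex2 \<Rightarrow> complex) \<longlongrightarrow> snd (0::complex2)) (nhds 0)"
    by (intro tendsto_intros filterlim_ident)
  then show ?thesis using False
    by (metis (mono_tags, lifting) eventually_mono snd_zero tendsto_imp_eventually_ne)
qed auto

lemma germ_non_dicritical: "non_dicritical germ_P germ_Q"
proof (rule non_dicritical.blow_up[OF germ_singular])
  have "pd1 germ_Q 0 = 0" "pd2 germ_Q 0 = 0" "pd1 germ_P 0 = 0" "pd2 germ_P 0 = 0"
    unfolding pd1_def pd2_def germ_P_def germ_Q_def
    by (auto intro!: DERIV_imp_deriv derivative_eq_intros)
  then show "\<not> reduced_singularity germ_P germ_Q"
    by (auto simp: reduced_singularity_def)
next
  show "\<forall>t. \<exists>A B. transform_at t germ_P germ_Q A B \<and> (\<forall>\<^sub>F s in nhds 0. B (0, s) = 0) \<and> non_dicritical A B"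
  proof
    fix t :: complex
    define A :: "complex2 \<Rightarrow> complex" where "A = (\<lambda>z. (t + snd z) * (1 + t + snd z))"
    define B :: "complex2 \<Rightarrow> complex" where "B = (\<lambda>z. - (fst z ^ 2))"
    have hol: "A holomorphic2_on UNIV" "B holomorphic2_on UNIV"
      unfolding A_def B_def by (intro holomorphic2_on_mult holomorphic2_on_add holomorphic2_on_const
        holomorphic2_on_power holomorphic2_on_uminus holomorphic2_on_fst holomorphic2_on_snd open_UNIV)+
    have "coprime_germs A B"
    proof (rule coprime_germsI)
      show "\<forall>\<^sub>F z in nhds 0. z \<noteq> 0 \<longrightarrow> A z \<noteq> 0 \<or> B z \<noteq> 0"
        using eventually_snd_near_0[of "-t"] eventually_snd_near_0[of "-1-t"]
      proof eventually_elim
        case (elim z)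
        then show ?case
        proof (cases "fst z = 0")
          case True
          have "snd z = - t \<or> snd z = - 1 - t" if "A z = 0"
          proof -
            have "t + snd z = 0 \<or> (1 + t) + snd z = 0" using that by (simp add: A_def)
            then show ?thesis unfolding add_eq_0_iff by auto
          qed
          with elim have "snd z = 0" if "A z = 0" using that by metis
          with True show ?thesis by (auto simp: prod_eq_iff)
        qed (simp add: B_def)
      qed
    qed
    then have fol: "foliation_germ A B"
      using hol by (simp add: foliation_germ_def holomorphic_germI)
    \<comment> \<open>The exponent 2 is the multiplicity of the form at the origin. No further power
      of x divides the pull-back, since the coefficient of dx is t (1 + t) on the divisor.\<close>
    have "transform_at t germ_P germ_Q A B"
      unfolding transform_at_def
      by (intro conjI fol exI[of _ 2] always_eventually)
         (auto simp: A_def B_def germ_P_def germ_Q_def algebra_simps power2_eq_square power3_eq_cube)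
    moreover have "\<forall>\<^sub>F s in nhds 0. B (0, s) = 0" by (simp add: B_def)
    moreover have "non_dicritical A B"
    proof (cases "t = 0 \<or> t = -1")
      case False
      then have "\<not> singular_germ A B"
        by (auto simp: singular_germ_def A_def add_eq_0_iff)
      then show ?thesis by (rule non_dicritical.regular)
    next
      case True
      have "pd1 B 0 = 0" "pd2 B 0 = 0" "pd1 A 0 = 0" "pd2 A 0 = 1 + 2 * t"
        unfolding pd1_def pd2_def A_def B_def
        by (auto intro!: DERIV_imp_deriv derivative_eq_intros simp: algebra_simps)
      moreover have "1 + 2 * t \<noteq> 0" using True by auto
      moreover have "singular_germ A B" using True by (auto simp: singular_germ_def A_def B_def)
      \<comment> \<open>A saddle-node: the zero eigenvalue has to be taken as \<open>\<mu>\<close>,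
        because \<open>\<nu>\<close> must not vanish; the ratio is then 0, which is not
        positive.\<close>
      ultimately have "reduced_singularity A B"
        unfolding reduced_singularity_def by (intro conjI exI[of _ 0] exI[of _ "1 + 2 * t"]) auto
      then show ?thesis by (rule non_dicritical.reduced)
    qed
    ultimately show "\<exists>A B. transform_at t germ_P germ_Q A B \<and> (\<forall>\<^sub>F s in nhds 0. B (0, s) = 0) \<and> non_dicritical A B"
      by blast
  qed
next
  define A :: "complex2 \<Rightarrow> complex" where "A = (\<lambda>z. snd z * (1 + fst z - fst z ^ 2 * snd z))"
  define B :: "complex2 \<Rightarrow> complex" where "B = (\<lambda>z. - (fst z * (1 + fst z)))"
  have hol: "A holomorphic2_on UNIV" "B holomorphic2_on UNIV"
    unfolding A_def B_def by (intro holomorphic2_on_mult holomorphic2_on_add holomorphic2_on_const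
      holomorphic2_on_power holomorphic2_on_uminus holomorphic2_on_diff holomorphic2_on_fst holomorphic2_on_snd open_UNIV)+
  have "coprime_germs A B"
  proof (rule coprime_germsI)
    show "\<forall>\<^sub>F z in nhds 0. z \<noteq> 0 \<longrightarrow> A z \<noteq> 0 \<or> B z \<noteq> 0"
      using eventually_fst_near_0[of "-1"]
    proof eventually_elim
      case (elim z)
      then show ?case
        by (cases z) (auto simp: A_def B_def zero_prod_def add_eq_0_iff)
    qed
  qed
  then have fol: "foliation_germ A B"
    using hol by (simp add: foliation_germ_def holomorphic_germI)
  have "transform_at_infinity germ_P germ_Q A B"
    unfolding transform_at_infinity_def
    by (intro conjI fol exI[of _ 2] always_eventually)
       (auto simp: A_def B_def germ_P_def germ_Q_def algebra_simps power2_eq_square power3_eq_cube)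
  moreover have "\<forall>\<^sub>F s in nhds 0. A (s, 0) = 0" by (simp add: A_def)
  moreover have "non_dicritical A B"
  proof -
    have "pd1 B 0 = -1" "pd2 B 0 = 0" "pd1 A 0 = 0" "pd2 A 0 = 1"
      unfolding pd1_def pd2_def A_def B_def
      by (auto intro!: DERIV_imp_deriv derivative_eq_intros simp: algebra_simps)
    moreover have "singular_germ A B" by (auto simp: singular_germ_def A_def B_def)
    moreover have "(-1::complex) \<noteq> of_rat q" if "q > 0" for q
    proof
      assume "(-1::complex) = of_rat q"
      then have "of_rat (-1) = (of_rat q :: complex)" by (simp add: of_rat_minus)
      then have "q = -1" using of_rat_eq_iff by metis
      with that show False by simp
    qed
    ultimately have "reduced_singularity A B"
      unfolding reduced_singularity_def by (intro conjI exI[of _ "-1"] exI[of _ 1]) auto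
    then show ?thesis by (rule non_dicritical.reduced)
  qed
  ultimately show "\<exists>A B. transform_at_infinity germ_P germ_Q A B \<and> (\<forall>\<^sub>F s in nhds 0. A (s, 0) = 0) \<and> non_dicritical A B"
    by blast
qed

section \<open>A commutator loop in the punctured plane\<close>

lemma homotopic_paths_Pair:
  assumes "homotopic_paths A p p'" "homotopic_paths B q q'"
  shows "homotopic_paths (A \<times> B) (\<lambda>t. (p t, q t)) (\<lambda>t. (p' t, q' t))"
proof -
  obtain h where h: "continuous_on ({0..1} \<times> {0..1}) h" "h \<in> {0..1} \<times> {0..1} \<rightarrow> A"
    "\<forall>x\<in>{0..1}. h (0, x) = p x" "\<forall>x\<in>{0..1}. h (1, x) = p' x"
    "\<forall>t\<in>{0..1::real}. pathstart (h \<circ> Pair t) = pathstart p \<and> pathfinish (h \<circ> Pair t) = pathfinish p"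
    using assms(1) unfolding homotopic_paths by blast
  obtain k where k: "continuous_on ({0..1} \<times> {0..1}) k" "k \<in> {0..1} \<times> {0..1} \<rightarrow> B"
    "\<forall>x\<in>{0..1}. k (0, x) = q x" "\<forall>x\<in>{0..1}. k (1, x) = q' x"
    "\<forall>t\<in>{0..1::real}. pathstart (k \<circ> Pair t) = pathstart q \<and> pathfinish (k \<circ> Pair t) = pathfinish q"
    using assms(2) unfolding homotopic_paths by blast
  show ?thesis
    unfolding homotopic_paths
    by (rule exI[of _ "\<lambda>z. (h z, k z)"])
       (use h k in \<open>auto intro!: continuous_on_Pair simp: pathstart_def pathfinish_def\<close>)
qed

text \<open>Only \<open>a\<close> has to contract: what remains is \<open>b\<close> followed by its
  reverse. The bracketing is that of \<open>lifted_commutator\<close>.\<close>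

lemma homotopic_paths_commutator_null:
  assumes a: "homotopic_paths S a (linepath p p)"
    and b: "path b" "path_image b \<subseteq> S" "pathstart b = p" "pathfinish b = p"
  shows "homotopic_paths S (a +++ (b +++ (reversepath a +++ reversepath b))) (linepath p p)"
proof -
  let ?c = "linepath p p"
  have ends: "pathstart a = p" "pathfinish a = p"
    using homotopic_paths_imp_pathstart[OF a] homotopic_paths_imp_pathfinish[OF a] by auto
  have p: "p \<in> S" using homotopic_paths_imp_subset[OF a] by auto
  have ra: "homotopic_paths S (reversepath a) ?c"
    using homotopic_paths_reversepath_D[OF a] by simp
  have rb: "path (reversepath b)" "path_image (reversepath b) \<subseteq> S" using b by auto
  have "homotopic_paths S (reversepath a +++ reversepath b) (?c +++ reversepath b)"
    by (rule homotopic_paths_join[OF ra]) (use rb b ends in auto)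
  also have "homotopic_paths S (?c +++ reversepath b) (reversepath b)"
    by (rule homotopic_paths_lid') (use rb b in auto)
  finally have "homotopic_paths S (b +++ (reversepath a +++ reversepath b)) (b +++ reversepath b)"
    by (intro homotopic_paths_join) (use b ends in auto)
  also have "homotopic_paths S (b +++ reversepath b) ?c"
    using homotopic_paths_rinv[OF b(1,2)] b by simp
  finally have "homotopic_paths S (a +++ (b +++ (reversepath a +++ reversepath b))) (?c +++ ?c)"
    by (intro homotopic_paths_join a) (use b ends in auto)
  also have "homotopic_paths S (?c +++ ?c) ?c"
    by (rule homotopic_paths_lid') (use p in auto)
  finally show ?thesis .
qed

text \<open>The difference takes values in 2 pi i Z, whose points are at distance at least 2 pi from
  each other.\<close>

lemma exp_lifts_differ_by_constant:
  fixes g h :: "'a::topological_space \<Rightarrow> complex"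
  assumes "connected T" "continuous_on T g" "continuous_on T h" "\<And>x. x \<in> T \<Longrightarrow> exp (g x) = exp (h x)"
  shows "\<exists>c. \<forall>x\<in>T. g x - h x = c"
proof -
  have "(\<lambda>x. g x - h x) constant_on T"
  proof (rule continuous_discrete_range_constant[OF assms(1)])
    show "continuous_on T (\<lambda>x. g x - h x)" using assms by (intro continuous_intros)
    fix x assume x: "x \<in> T"
    have "2 * pi \<le> norm ((g y - h y) - (g x - h x))"
      if y: "y \<in> T" and ne: "g y - h y \<noteq> g x - h x" for y
    proof -
      have "exp ((g y - h y) - (g x - h x)) = 1"
        using assms(4)[OF x] assms(4)[OF y] by (simp add: exp_diff)
      then obtain n :: int where n: "Re ((g y - h y) - (g x - h x)) = 0" "Im ((g y - h y) - (g x - h x)) = of_int (2 * n) * pi"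
        using exp_eq_1 by metis
      with ne have "n \<noteq> 0" by (auto simp: complex_eq_iff)
      then have "1 \<le> \<bar>real_of_int n\<bar>" by linarith
      then have "2 * pi \<le> \<bar>Im ((g y - h y) - (g x - h x))\<bar>"
        by (subst n(2)) (simp add: abs_mult)
      then show ?thesis using abs_Im_le_cmod order_trans by blast
    qed
    then show "\<exists>e>0. \<forall>y. y \<in> T \<and> g y - h y \<noteq> g x - h x \<longrightarrow> e \<le> norm (g y - h y - (g x - h x))"
      by (intro exI[of _ "2 * pi"]) auto
  qed
  then show ?thesis unfolding constant_on_def .
qed

text \<open>Homotopy lifting for the covering exp. The lift is a logarithm of the homotopy on the
  contractible square, corrected by a period so that it starts at \<open>p\<close>.\<close>

lemma exp_lift_null_homotopy:
  fixes p :: "real \<Rightarrow> complex"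
  assumes hom: "homotopic_paths S (exp \<circ> p) (\<lambda>_. a)" and S: "0 \<notin> S"
    and p: "path p" "pathfinish p = pathstart p"
  shows "homotopic_paths (exp -` S) p (\<lambda>_. pathstart p)"
proof -
  let ?I = "{0..1::real}"
  obtain h where h: "continuous_on (?I \<times> ?I) h" "h \<in> ?I \<times> ?I \<rightarrow> S"
    "\<forall>s\<in>?I. h (0, s) = exp (p s)" "\<forall>s\<in>?I. h (1, s) = a"
    "\<forall>t\<in>?I. h (t, 0) = exp (p 0) \<and> h (t, 1) = exp (p 1)"
    using hom unfolding homotopic_paths pathstart_def pathfinish_def o_def by blast
  have p01: "p 1 = p 0" using p by (simp add: pathstart_def pathfinish_def)
  have "contractible (?I \<times> ?I)" by (intro convex_imp_contractible convex_Times) auto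
  moreover have "h z \<noteq> 0" if "z \<in> ?I \<times> ?I" for z using funcset_mem[OF h(2) that] S by auto
  ultimately obtain k where k: "continuous_on (?I \<times> ?I) k" "\<And>z. z \<in> ?I \<times> ?I \<Longrightarrow> h z = exp (k z)"
    by (rule continuous_logarithm_on_contractible[OF h(1)]) (assumption, rule that, assumption, simp)
  have slices: "continuous_on ?I (\<lambda>s. k (u, s))" "continuous_on ?I (\<lambda>t. k (t, u))" if "u \<in> ?I" for u
    by (intro continuous_on_compose2[OF k(1)] continuous_intros; use that in auto)+
  have cI: "connected ?I" by simp
  have 01: "0 \<in> ?I" "1 \<in> ?I" by auto
  have top: "\<forall>s\<in>?I. exp (k (0, s)) = exp (p s)"
    using k(2) h(3) by (metis SigmaI atLeastAtMost_iff zero_le_one order_refl)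
  then obtain d where d: "\<forall>s\<in>?I. k (0, s) - p s = d"
    using exp_lifts_differ_by_constant[OF cI slices(1), of 0 p] p(1) unfolding path_def by force
  have "\<forall>t\<in>?I. exp (k (t, 0)) = exp (p 0)"
    using k(2) h(5) by (metis SigmaI atLeastAtMost_iff zero_le_one order_refl)
  then obtain d0 where d0: "\<forall>t\<in>?I. k (t, 0) - p 0 = d0"
    using exp_lifts_differ_by_constant[OF cI slices(2) continuous_on_const, of 0 "p 0"] by force
  have "\<forall>t\<in>?I. exp (k (t, 1)) = exp (p 1)"
    using k(2) h(5) by (metis SigmaI atLeastAtMost_iff zero_le_one order_refl)
  then obtain d1 where d1: "\<forall>t\<in>?I. k (t, 1) - p 1 = d1"
    using exp_lifts_differ_by_constant[OF cI slices(2) continuous_on_const, of 1 "p 1"] by force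
  have "\<forall>s\<in>?I. exp (k (1, s)) = a"
    using k(2) h(4) by (metis SigmaI atLeastAtMost_iff zero_le_one order_refl)
  then have "\<forall>s\<in>?I. exp (k (1, s)) = exp (k (1, 0))"
    by (metis atLeastAtMost_iff order_refl zero_le_one)
  then have "\<exists>d2. \<forall>s\<in>?I. k (1, s) - k (1, 0) = d2"
    by (intro exp_lifts_differ_by_constant[OF cI slices(1) continuous_on_const]) (rule 01(2), erule bspec, assumption)
  then obtain d2 where d2: "\<forall>s\<in>?I. k (1, s) - k (1, 0) = d2" by blast
  \<comment> \<open>On each side of the square the logarithm is known up to a constant. The corners
    identify these constants, so subtracting the single period \<open>d\<close> corrects all four
    sides at once.\<close>
  have "k (0, 0) - p 0 = d" "k (0, 0) - p 0 = d0" "k (0, 1) - p 1 = d" "k (0, 1) - p 1 = d1"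
    "k (1, 0) - k (1, 0) = d2" "k (1, 0) - p 0 = d0" "exp (k (0, 0)) = exp (p 0)"
    using bspec[OF d 01(1)] bspec[OF d 01(2)] bspec[OF d0 01(1)] bspec[OF d0 01(2)] bspec[OF d1 01(1)]
      bspec[OF d2 01(1)] bspec[OF top 01(1)] by simp_all
  then have eqs: "d0 = d" "d1 = d" "d2 = 0" "k (1, 0) - p 0 = d" "exp d = 1"
    by (auto simp: exp_diff)
  have e: "exp (k z - d) = h z" if "z \<in> ?I \<times> ?I" for z
    using k(2)[OF that] eqs(5) by (simp add: exp_diff)
  show ?thesis
    unfolding homotopic_paths
  proof (intro exI[of _ "\<lambda>z. k z - d"] conjI ballI)
    show "continuous_on (?I \<times> ?I) (\<lambda>z. k z - d)" using k(1) by (intro continuous_intros)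
    show "(\<lambda>z. k z - d) \<in> ?I \<times> ?I \<rightarrow> exp -` S" 
      using funcset_mem[OF h(2)] e by (intro funcsetI) simp
    fix s assume s: "s \<in> ?I"
    show "k (0, s) - d = p s" using bspec[OF d s] by (simp add: diff_eq_eq)
    show "k (1, s) - d = pathstart p"
      using bspec[OF d2 s] eqs(3,4) by (simp add: pathstart_def diff_eq_eq)
    show "pathstart ((\<lambda>z. k z - d) \<circ> Pair s) = pathstart p"
      using bspec[OF d0 s] eqs(1) by (simp add: pathstart_def diff_eq_eq)
    show "pathfinish ((\<lambda>z. k z - d) \<circ> Pair s) = pathfinish p"
      using bspec[OF d1 s] eqs(2) by (simp add: pathfinish_def diff_eq_eq)
  qed
qed

text \<open>In the coordinate \<open>log \<zeta>\<close>: a vertical segment over the circle \<open>|\<zeta>| = e\<^sup>L\<close>, and a circle of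
  radius \<open>d\<close> tangent to it.\<close>

definition turn_path :: "real \<Rightarrow> real \<Rightarrow> complex" where
  "turn_path L = linepath (Complex L pi) (Complex L (3 * pi))"

definition hole_path :: "real \<Rightarrow> real \<Rightarrow> real \<Rightarrow> complex" where
  "hole_path L d t = Complex (L + d) pi - of_real d * exp (2 * of_real pi * \<i> * of_real t)"

text \<open>The turn ends one sheet higher than it starts, so the first circle is translated by 2 pi
  i to fit onto it; exp removes the translation and leaves a commutator.\<close>

definition lifted_commutator :: "real \<Rightarrow> real \<Rightarrow> real \<Rightarrow> complex" where
  "lifted_commutator L d =
     turn_path L +++ (((\<lambda>z. z + 2 * of_real pi * \<i>) \<circ> hole_path L d) +++
       (reversepath (turn_path L) +++ reversepath (hole_path L d)))"

lemma path_turn [simp]: "path (turn_path L)" "pathstart (turn_path L) = Complex L pi"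
    "pathfinish (turn_path L) = Complex L (3 * pi)"
  by (simp_all add: turn_path_def)

lemma path_hole [simp]: "path (hole_path L d)"
  unfolding path_def hole_path_def[abs_def] by (intro continuous_intros)

lemma hole_ends [simp]:
  "pathstart (hole_path L d) = Complex L pi" "pathfinish (hole_path L d) = Complex L pi"
  by (simp_all add: hole_path_def pathstart_def pathfinish_def complex_eq_iff exp_two_pi_i')

lemma norm_hole: "d > 0 \<Longrightarrow> norm (hole_path L d t - Complex (L + d) pi) = d"
  by (simp add: hole_path_def norm_mult norm_exp_eq_Re)

lemma shift_hole:
  "path ((\<lambda>z. z + 2 * of_real pi * \<i>) \<circ> hole_path L d)"
  "pathstart ((\<lambda>z. z + 2 * of_real pi * \<i>) \<circ> hole_path L d) = Complex L (3 * pi)"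
  "pathfinish ((\<lambda>z. z + 2 * of_real pi * \<i>) \<circ> hole_path L d) = Complex L (3 * pi)"
  by (intro path_continuous_image continuous_intros path_hole)
     (simp_all add: pathstart_compose pathfinish_compose complex_eq_iff)

lemma lifted_commutator_path:
  "path (lifted_commutator L d)" "pathstart (lifted_commutator L d) = Complex L pi"
  "pathfinish (lifted_commutator L d) = Complex L pi"
  by (simp_all add: lifted_commutator_def shift_hole)

lemma hole_half_plane:
  assumes "d > 0"
  shows "Re (hole_path L d t) \<ge> L"
proof -
  have "\<bar>Re (hole_path L d t - Complex (L + d) pi)\<bar> \<le> d"
    using abs_Re_le_cmod norm_hole[OF assms] by metis
  then show ?thesis by simp
qed

lemma turn_image: "path_image (turn_path L) \<subseteq> {z. Re z = L}"
proof -
  have "convex {z. Re z = L}"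
    by (simp add: convex_alt) (simp add: algebra_simps)
  then show ?thesis
    unfolding turn_path_def path_image_linepath by (intro closed_segment_subset) auto
qed

lemma lifted_commutator_half_plane:
  assumes "d > 0"
  shows "path_image (lifted_commutator L d) \<subseteq> {z. Re z \<ge> L}"
proof -
  have "path_image (hole_path L d) \<subseteq> {z. Re z \<ge> L}"
    using hole_half_plane[OF assms] by (auto simp: path_image_def)
  moreover from this have "path_image ((\<lambda>z. z + 2 * of_real pi * \<i>) \<circ> hole_path L d) \<subseteq> {z. Re z \<ge> L}"
    by (auto simp: path_image_compose)
  ultimately show ?thesis
    unfolding lifted_commutator_def using turn_image[of L]
    by (intro subset_path_image_join) auto
qed

text \<open>The two circles contained in the path lie over the same circle but on different sheets of
  the logarithm; only the second one encloses the given point.\<close>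

lemma winding_number_lifted_commutator:
  assumes d: "0 < d" "d < 2 * pi"
  shows "winding_number (lifted_commutator L d) (Complex (L + d) pi) = -1"
    and "Complex (L + d) pi \<notin> path_image (lifted_commutator L d)"
proof -
  let ?z = "Complex (L + d) pi" and ?s = "(\<lambda>z. z + 2 * of_real pi * \<i>) \<circ> hole_path L d"
  have t: "?z \<notin> path_image (turn_path L)" using turn_image[of L] d by auto
  have h: "?z \<notin> path_image (hole_path L d)" 
  proof -
    have "hole_path L d t \<noteq> ?z" for t using norm_hole[OF d(1), of L t] d by auto
    then show ?thesis unfolding path_image_def by fastforce
  qed
  have simg: "path_image ?s \<subseteq> cball (?z + 2 * of_real pi * \<i>) d"
  proof -
    have "norm (?s t - (?z + 2 * of_real pi * \<i>)) = d" for t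
      using norm_hole[OF d(1), of L t] by (simp add: algebra_simps)
    then show ?thesis by (auto simp: path_image_def dist_norm norm_minus_commute)
  qed
  have far: "?z \<notin> cball (?z + 2 * of_real pi * \<i>) d"
    \<comment> \<open>The translated circle is centred 2 pi above the point and has radius
      \<open>d\<close>, less than 2 pi, so it does not enclose the point.\<close>
    using d by (simp add: dist_norm norm_mult)
  have s: "?z \<notin> path_image ?s" using simg far by blast
  have ws: "winding_number ?s ?z = 0"
    by (rule winding_number_zero_outside[OF _ convex_cball _ far simg]) (simp_all add: shift_hole)
  have "winding_number (hole_path L d) ?z = winding_number (\<lambda>t. hole_path L d t - ?z) 0"
    by (rule winding_number_offset)
  \<comment> \<open>The summand pi i accounts for the minus sign in \<open>hole_path\<close>. In
    this form the winding number is the increment of the exponent divided by 2 pi i.\<close>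
  also have "(\<lambda>t. hole_path L d t - ?z) = exp \<circ> (\<lambda>t. of_real (ln d) + of_real pi * \<i> + 2 * of_real pi * \<i> * of_real t)"
    using d by (auto simp: hole_path_def fun_eq_iff exp_add exp_of_real)
  also have "winding_number \<dots> 0 = 1"
    by (subst winding_number_compose_exp)
       (auto simp: path_def pathstart_def pathfinish_def intro!: continuous_intros)
  finally have wh: "winding_number (hole_path L d) ?z = 1" .
  have paths: "path (reversepath (turn_path L) +++ reversepath (hole_path L d))"
    "path (?s +++ (reversepath (turn_path L) +++ reversepath (hole_path L d)))"
    by (simp_all add: shift_hole)
  have notin: "?z \<notin> path_image (reversepath (turn_path L) +++ reversepath (hole_path L d))"
    using t h by (simp add: path_image_join)
  have notin': "?z \<notin> path_image (?s +++ (reversepath (turn_path L) +++ reversepath (hole_path L d)))"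
    using notin s by (subst path_image_join) (simp_all add: shift_hole)
  show "?z \<notin> path_image (lifted_commutator L d)"
    unfolding lifted_commutator_def using notin' t by (subst path_image_join) (simp_all add: shift_hole)
  have "winding_number (lifted_commutator L d) ?z = winding_number (turn_path L) ?z +
      (winding_number ?s ?z + (winding_number (reversepath (turn_path L)) ?z +
        winding_number (reversepath (hole_path L d)) ?z))"
    unfolding lifted_commutator_def using t h s notin notin' paths
    by (simp add: winding_number_join shift_hole)
  also have "\<dots> = -1"
    using t h ws wh by (simp add: winding_number_reversepath)
  finally show "winding_number (lifted_commutator L d) ?z = -1" .
qed

text \<open>A null homotopy would lift to the complement of all logarithms of the removed point, in
  particular of the one about which the lift has winding number -1.\<close>

lemma commutator_not_null_homotopic:
  assumes d: "0 < d" "d < 2 * pi"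
  shows "\<not> homotopic_paths (- {0, exp (Complex (L + d) pi)}) (exp \<circ> lifted_commutator L d) (\<lambda>_. a)"
proof
  let ?z = "Complex (L + d) pi" and ?p = "lifted_commutator L d"
  assume "homotopic_paths (- {0, exp ?z}) (exp \<circ> ?p) (\<lambda>_. a)"
  then have "homotopic_paths (exp -` (- {0, exp ?z})) ?p (\<lambda>_. pathstart ?p)"
    by (rule exp_lift_null_homotopy) (simp_all add: lifted_commutator_path)
  then have "homotopic_paths (- {?z}) ?p (\<lambda>_. pathstart ?p)"
    by (rule homotopic_paths_subset) auto
  then have "winding_number ?p ?z = winding_number (\<lambda>_. pathstart ?p) ?z"
    by (rule winding_number_homotopic_paths)
  also have "\<dots> = 0"
    using winding_number_lifted_commutator(2)[OF d, of L] pathstart_in_path_image[of ?p]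
    by (intro winding_number_zero_const) auto
  finally show False using winding_number_lifted_commutator(1)[OF d] by simp
qed

section \<open>Choice of constants, and contraction of the loop in two domains\<close>

lemma exp_minus_one_bounds:
  fixes w :: complex
  assumes "norm w \<le> 1/4"
  shows "norm w * (1 - 4/3 * norm w) \<le> norm (exp w - 1)" "norm (exp w - 1) \<le> norm w * (1 + 4/3 * norm w)"
proof -
  \<comment> \<open>This gives e^(1/4) at most 4/3, the constant in the quadratic remainder of exp w
    - 1 against w.\<close>
  have "3/4 \<le> exp (- (1/4::real))" using exp_ge_add_one_self[of "-(1/4::real)"] by simp
  then have "exp (1/4::real) \<le> 4/3" by (simp add: exp_minus field_simps)
  moreover have "\<bar>Re w\<bar> \<le> 1/4" using abs_Re_le_cmod[of w] assms by linarith
  ultimately have e: "exp \<bar>Re w\<bar> \<le> 4/3" by (meson exp_le_cancel_iff order_trans)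
  have "norm (exp w - (1 + w)) \<le> exp \<bar>Re w\<bar> * norm w ^ 2"
    using Taylor_exp[of w 1] by (simp add: power2_eq_square)
  also have "\<dots> \<le> 4/3 * norm w ^ 2" using e by (intro mult_right_mono) auto
  finally have *: "norm (exp w - 1 - w) \<le> norm w * (4/3 * norm w)"
    by (simp add: power2_eq_square algebra_simps)
  have "norm w \<le> norm (exp w - 1) + norm (exp w - 1 - w)"
    using norm_triangle_ineq4[of "exp w - 1" "exp w - 1 - w"] by simp
  then show "norm w * (1 - 4/3 * norm w) \<le> norm (exp w - 1)" using * by (simp add: algebra_simps)
  have "norm (exp w - 1) \<le> norm w + norm (exp w - 1 - w)"
    using norm_triangle_ineq[of w "exp w - 1 - w"] by simp
  then show "norm (exp w - 1) \<le> norm w * (1 + 4/3 * norm w)" using * by (simp add: algebra_simps)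
qed

lemma homotopic_paths_null_convex:
  fixes S :: "'a::real_normed_vector set"
  assumes "convex S" "path p" "path_image p \<subseteq> S" "pathfinish p = pathstart p"
  shows "homotopic_paths S p (linepath (pathstart p) (pathstart p))"
  using convex_imp_simply_connected[OF assms(1)] assms(2-) simply_connected_eq_contractible_path by blast

lemma exp_Complex_pi: "exp (Complex x pi) = - of_real (exp x)"
  by (simp add: exp_eq_polar cis_conv_exp[symmetric] complex_eq_iff exp_Euler Re_exp Im_exp)

text \<open>1/R is the size of x on the loop. As c lies on the negative axis beyond -R, all poles c
  + 2 pi i n have real part below -R and miss the disc of radius R. With R d = 1/8 the second loop
  is roughly a circle of radius 1/8 around c, small against the distance 2 pi between poles.\<close>

context
  fixes R d :: real and c :: complex
  assumes R: "R \<ge> 1" and d: "d = 1 / (8 * R)" and c: "c = - of_real (R * exp d)"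
begin

lemma hole_radius_bounds: "0 < d" "d \<le> 1/8" "d < 2 * pi"
proof -
  show "0 < d" "d \<le> 1/8" using R by (auto simp: d field_simps)
  then show "d < 2 * pi" using pi_gt3 by linarith
qed

lemma hole_centre: "exp (Complex (ln R + d) pi) = c"
  using R by (simp add: exp_Complex_pi c exp_add)

text \<open>The lift is a closed path in a convex half-plane; its contraction there is projected by
  exp.\<close>

lemma lifted_commutator_null_outside:
  "homotopic_paths {z. R \<le> norm z} (exp \<circ> lifted_commutator (ln R) d) (\<lambda>_. - of_real R)"
proof -
  have "homotopic_paths {z. Re z \<ge> ln R} (lifted_commutator (ln R) d)
      (linepath (Complex (ln R) pi) (Complex (ln R) pi))"
    using homotopic_paths_null_convex[OF _ lifted_commutator_path(1) lifted_commutator_half_plane[OF hole_radius_bounds(1)]]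
    by (simp add: lifted_commutator_path convex_halfspace_Re_ge)
  then have "homotopic_paths {z. R \<le> norm z} (exp \<circ> lifted_commutator (ln R) d)
      (exp \<circ> linepath (Complex (ln R) pi) (Complex (ln R) pi))"
  proof (rule homotopic_paths_continuous_image)
    show "exp \<in> {z. ln R \<le> Re z} \<rightarrow> {z. R \<le> norm (z::complex)}"
    proof
      fix z :: complex assume "z \<in> {z. ln R \<le> Re z}"
      then have "exp (ln R) \<le> exp (Re z)" by simp
      then show "exp z \<in> {z. R \<le> norm z}" using R by (simp add: norm_exp_eq_Re)
    qed
  qed (intro continuous_intros)
  moreover have "exp \<circ> linepath (Complex (ln R) pi) (Complex (ln R) pi) = (\<lambda>_. - of_real R)"
    using R by (simp add: linepath_refl exp_Complex_pi o_def)
  ultimately show ?thesis by simp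
qed

text \<open>The real part of c is at most -R - R d = -R - 1/8, so exp (c - z) has modulus at most
  e^(-1/8), hence at most 8/9. The value 1/18, below the resulting 1/9, is shared with the bound on
  the loop around c.\<close>

lemma disc_avoids_holes:
  assumes "norm z \<le> R"
  shows "1/18 \<le> norm (exp (c - z) - 1)"
proof -
  have "R * (1 + d) \<le> R * exp d" using R exp_ge_add_one_self[of d] by (intro mult_left_mono) auto
  moreover have "R * d = 1/8" using R by (simp add: d)
  moreover have "- R \<le> Re z" using assms abs_Re_le_cmod[of z] by linarith
  ultimately have "Re (c - z) \<le> - (1/8)" by (simp add: c algebra_simps)
  then have "norm (exp (c - z)) \<le> exp (- (1/8))" by (simp add: norm_exp_eq_Re)
  also have "\<dots> \<le> 8/9" using exp_ge_add_one_self[of "1/8::real"] by (simp add: exp_minus field_simps)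
  finally have "norm (exp (c - z)) \<le> 8/9" .
  then show ?thesis using norm_triangle_ineq2[of 1 "exp (c - z)"] by (simp add: norm_minus_commute)
qed

text \<open>The approximation of exp w - 1 by w is used twice: from log \<zeta> to \<zeta>, giving
  5/48 and 1/6 as bounds for the distance to c, and then from c - \<zeta> to exp (c - \<zeta>) -
  1.\<close>

lemma hole_path_avoids_holes: "1/18 \<le> norm (exp (c - exp (hole_path (ln R) d t)) - 1)"
proof -
  define w where "w = hole_path (ln R) d t - Complex (ln R + d) pi"
  have w: "norm w = d" using norm_hole[OF hole_radius_bounds(1)] by (simp add: w_def)
  define q where "q = exp w - 1"
  have q: "d * (1 - 4/3 * d) \<le> norm q" "norm q \<le> d * (1 + 4/3 * d)"
    using exp_minus_one_bounds[of w] w hole_radius_bounds by (auto simp: q_def)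
  have Rd: "R * d = 1/8" using R by (simp add: d)
  have "d * (5/6) \<le> d * (1 - 4/3 * d)" "d * (1 + 4/3 * d) \<le> d * (7/6)"
    using hole_radius_bounds by (intro mult_left_mono; simp)+
  with q have q': "d * (5/6) \<le> norm q" "norm q \<le> d * (7/6)" by linarith+
  have "7/8 \<le> exp (- d)" using exp_ge_add_one_self[of "-d"] hole_radius_bounds by linarith
  then have ed: "1 \<le> exp d" "exp d \<le> 8/7" using hole_radius_bounds by (auto simp: exp_minus field_simps)
  define \<xi> where "\<xi> = c - exp (hole_path (ln R) d t)"
  have "exp (hole_path (ln R) d t) = c * exp w"
    unfolding hole_centre[symmetric] exp_add[symmetric] by (simp add: w_def)
  then have "\<xi> = - c * q" by (simp add: \<xi>_def q_def algebra_simps)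
  then have n\<xi>: "norm \<xi> = R * exp d * norm q" using R by (simp add: c norm_mult)
  have "R * 1 * (d * (5/6)) \<le> R * exp d * norm q"
    using q' ed R hole_radius_bounds by (intro mult_mono) auto
  then have lo: "5/48 \<le> norm \<xi>" using Rd n\<xi> by (simp add: algebra_simps)
  have "R * exp d * norm q \<le> R * (8/7) * (d * (7/6))"
    using q' ed R hole_radius_bounds by (intro mult_mono) auto
  then have hi: "norm \<xi> \<le> 1/6" using Rd n\<xi> by (simp add: algebra_simps)
  have "5/48 * (7/9) \<le> norm \<xi> * (1 - 4/3 * norm \<xi>)"
    using lo hi by (intro mult_mono) auto
  also have "\<dots> \<le> norm (exp \<xi> - 1)" using exp_minus_one_bounds[of \<xi>] hi by auto
  finally show ?thesis by (simp add: \<xi>_def)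
qed

text \<open>The first loop runs inside the disc of radius R, which is convex and contained in the
  domain, so it contracts; the loop around c need not, by
  \<open>homotopic_paths_commutator_null\<close>.\<close>

lemma lifted_commutator_null_away_from_holes:
  "homotopic_paths {z. 1/18 \<le> norm (exp (c - z) - 1)} (exp \<circ> lifted_commutator (ln R) d) (\<lambda>_. - of_real R)"
proof -
  let ?B = "{z. 1/18 \<le> norm (exp (c - z) - 1)}"
  define a where "a = exp \<circ> turn_path (ln R)"
  define b where "b = exp \<circ> hole_path (ln R) d"
  have start: "exp (Complex (ln R) pi) = - of_real R" "exp (Complex (ln R) (3 * pi)) = - of_real R"
  proof -
    show *: "exp (Complex (ln R) pi) = - of_real R" using R by (simp add: exp_Complex_pi)
    have "Complex (ln R) (3 * pi) = Complex (ln R) pi + 2 * of_real pi * \<i>" by (simp add: complex_eq_iff)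
    then show "exp (Complex (ln R) (3 * pi)) = - of_real R" using * by (simp only: exp_add exp_two_pi_i mult_1_right)
  qed
  have pa: "path a" unfolding a_def by (intro path_continuous_image continuous_intros) simp
  have ea: "pathstart a = - of_real R" "pathfinish a = - of_real R"
    by (simp_all add: a_def pathstart_compose pathfinish_compose start)
  have "norm (exp z) = R" if "z \<in> path_image (turn_path (ln R))" for z
    using turn_image[of "ln R"] that R by (auto simp: norm_exp_eq_Re)
  then have "path_image a \<subseteq> cball 0 R" by (auto simp: a_def path_image_compose)
  then have "homotopic_paths (cball 0 R) a (linepath (- of_real R) (- of_real R))"
    using homotopic_paths_null_convex[of "cball 0 R" a] pa ea by auto
  then have a: "homotopic_paths ?B a (linepath (- of_real R) (- of_real R))"
    by (rule homotopic_paths_subset) (use disc_avoids_holes in auto)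
  have b: "path b" "path_image b \<subseteq> ?B" "pathstart b = - of_real R" "pathfinish b = - of_real R"
  proof -
    show "path b" unfolding b_def by (intro path_continuous_image continuous_intros) simp
    show "path_image b \<subseteq> ?B" using hole_path_avoids_holes by (auto simp: b_def path_image_def)
  qed (simp_all add: b_def pathstart_compose pathfinish_compose start)
  have "exp \<circ> ((\<lambda>z. z + 2 * of_real pi * \<i>) \<circ> hole_path (ln R) d) = b"
    by (simp add: b_def o_def exp_add exp_two_pi_i)
  then have "exp \<circ> lifted_commutator (ln R) d = a +++ (b +++ (reversepath a +++ reversepath b))"
    unfolding lifted_commutator_def path_compose_join path_compose_reversepath a_def[symmetric] b_def[symmetric]
    by simp
  then show ?thesis using homotopic_paths_commutator_null[OF a b] by (simp add: linepath_refl)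
qed

end

definition leaf_graph :: "complex \<Rightarrow> complex \<Rightarrow> complex2" where
  "leaf_graph c z = (1 / z, 1 / (z * (exp (c - z) - 1)))"

text \<open>Decoupling the two occurrences of \<open>\<zeta>\<close> in \<open>leaf_graph\<close> allows to contract the loop separately
  in \<open>{|\<zeta>| \<ge> R}\<close> and in the complement of the poles \<open>c + 2 \<pi> i n\<close>.\<close>

lemma small_null_homotopic_loop:
  assumes "\<epsilon> > 0"
  shows "\<exists>(\<kappa> :: real \<Rightarrow> complex) c. path \<kappa> \<and> pathfinish \<kappa> = pathstart \<kappa> \<and>
    (\<forall>z\<in>path_image \<kappa>. z \<noteq> 0 \<and> exp (c - z) \<noteq> 1) \<and>
    (\<forall>a. \<not> homotopic_paths (- {0, c}) \<kappa> (\<lambda>_. a)) \<and>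
    homotopic_paths {z. norm z < \<epsilon> \<and> fst z \<noteq> 0 \<and> snd z \<noteq> 0 \<and> fst z + snd z \<noteq> 0}
       (leaf_graph c \<circ> \<kappa>) (\<lambda>_. leaf_graph c (pathstart \<kappa>))"
proof -
  \<comment> \<open>The first coordinate is at most 1/R and the second at most 18/R, as the factor
    exp (c - v) - 1 is at least 1/18. The sum 19/R falls below \<open>\<epsilon>\<close> once R is
    at least 20/\<epsilon>.\<close>
  define R where "R = max 1 (20 / \<epsilon>)"
  define d where "d = 1 / (8 * R)"
  define c :: complex where "c = - of_real (R * exp d)"
  define \<kappa> where "\<kappa> = exp \<circ> lifted_commutator (ln R) d"
  have R: "R \<ge> 1" "20 / \<epsilon> \<le> R" by (auto simp: R_def)
  have "19 < \<epsilon> * R" using R(2) assms by (simp add: field_simps)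
  then have small: "19 / R < \<epsilon>" using R(1) by (simp add: field_simps)
  let ?A = "{z::complex. R \<le> norm z}" and ?B = "{z. 1/18 \<le> norm (exp (c - z) - 1)}"
  let ?\<Omega> = "{z::complex2. norm z < \<epsilon> \<and> fst z \<noteq> 0 \<and> snd z \<noteq> 0 \<and> fst z + snd z \<noteq> 0}"
  note ctx = R(1) d_def c_def
  have A: "homotopic_paths ?A \<kappa> (\<lambda>_. - of_real R)"
    unfolding \<kappa>_def by (rule lifted_commutator_null_outside[OF ctx])
  have B: "homotopic_paths ?B \<kappa> (\<lambda>_. - of_real R)"
    unfolding \<kappa>_def by (rule lifted_commutator_null_away_from_holes[OF ctx])
  define E :: "complex \<times> complex \<Rightarrow> complex2"
    where "E = (\<lambda>u. (1 / fst u, 1 / (fst u * (exp (c - snd u) - 1))))"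
  have ne: "fst u \<noteq> 0" "exp (c - snd u) - 1 \<noteq> 0" if "u \<in> ?A \<times> ?B" for u
    using that R(1) by auto
  have AB: "homotopic_paths (?A \<times> ?B) (\<lambda>t. (\<kappa> t, \<kappa> t)) (\<lambda>t. (- of_real R, - of_real R))"
    by (rule homotopic_paths_Pair[OF A B])
  have hom: "homotopic_paths ?\<Omega> (E \<circ> (\<lambda>t. (\<kappa> t, \<kappa> t))) (E \<circ> (\<lambda>t. (- of_real R, - of_real R)))"
  proof (rule homotopic_paths_continuous_image[OF AB])
    show "continuous_on (?A \<times> ?B) E"
      unfolding E_def using ne by (intro continuous_intros) auto
    show "E \<in> ?A \<times> ?B \<rightarrow> ?\<Omega>"
    proof
      fix u assume u: "u \<in> ?A \<times> ?B"
      define x where "x = 1 / fst u"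
      define m where "m = exp (c - snd u) - 1"
      have m: "m \<noteq> 0" "1/18 \<le> norm m" and x: "x \<noteq> 0" using ne[OF u] u by (auto simp: m_def x_def)
      have E: "E u = (x, x / m)" by (simp add: E_def x_def m_def)
      have "norm x \<le> 1 / R" using u R(1) by (auto simp: x_def norm_divide intro!: divide_left_mono mult_pos_pos)
      moreover have "norm (x / m) \<le> (1 / R) / (1 / 18)"
        unfolding norm_divide using calculation m(2) by (intro frac_le) (use R(1) in auto)
      moreover have "norm (E u) \<le> norm x + norm (x / m)" unfolding E by (rule norm_Pair_le)
      ultimately have "norm (E u) < \<epsilon>" using small by simp
      moreover have "x + x / m \<noteq> 0"
      proof -
        have "x + x / m = x * exp (c - snd u) / m" using m(1) by (simp add: field_simps) (simp add: m_def algebra_simps)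
        then show ?thesis using x m(1) by simp
      qed
      ultimately show "E u \<in> ?\<Omega>" using x m(1) E by simp
    qed
  qed
  have E1: "E \<circ> (\<lambda>t. (\<kappa> t, \<kappa> t)) = leaf_graph c \<circ> \<kappa>"
    by (simp add: E_def leaf_graph_def o_def)
  have start: "pathstart \<kappa> = - of_real R" "pathfinish \<kappa> = - of_real R"
    using homotopic_paths_imp_pathstart[OF A] homotopic_paths_imp_pathfinish[OF A]
    by (simp_all add: pathstart_def pathfinish_def)
  have E2: "E \<circ> (\<lambda>t. (- of_real R, - of_real R)) = (\<lambda>_. leaf_graph c (pathstart \<kappa>))"
    by (simp add: E_def leaf_graph_def o_def start)
  have 5: "homotopic_paths ?\<Omega> (leaf_graph c \<circ> \<kappa>) (\<lambda>_. leaf_graph c (pathstart \<kappa>))"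
    using hom unfolding E1 E2 .
  have 3: "z \<noteq> 0 \<and> exp (c - z) \<noteq> 1" if "z \<in> path_image \<kappa>" for z
  proof -
    have "z \<in> ?A" "z \<in> ?B"
      using homotopic_paths_imp_subset[OF A] homotopic_paths_imp_subset[OF B] that by blast+
    then show ?thesis using R(1) by auto
  qed
  have 4: "\<not> homotopic_paths (- {0, c}) \<kappa> (\<lambda>_. a)" for a
    using commutator_not_null_homotopic[OF hole_radius_bounds(1,3)[OF ctx], of "ln R" a] hole_centre[OF ctx]
    unfolding \<kappa>_def by simp
  have 1: "path \<kappa>" using homotopic_paths_imp_path[OF A] by blast
  have 2: "pathfinish \<kappa> = pathstart \<kappa>" using start by simp
  show ?thesis using 1 2 3 4 5 by blast
qed

section \<open>Leaves\<close>

text \<open>With H a primitive of h, the product g exp (-H) is constant. This is the source of every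
  invariance statement below, in place of flow boxes.\<close>

lemma linear_ode_zero_or_nonzero:
  assumes h: "h holomorphic_on ball a e"
    and g: "\<And>\<zeta>. \<zeta> \<in> ball a e \<Longrightarrow> (g has_field_derivative h \<zeta> * g \<zeta>) (at \<zeta>)"
    and z: "\<zeta> \<in> ball a e" "\<zeta>' \<in> ball a e"
  shows "g \<zeta> = 0 \<longleftrightarrow> g \<zeta>' = 0"
proof -
  obtain H where H0: "\<And>x. x \<in> ball a e \<Longrightarrow> (H has_field_derivative h x) (at x within ball a e)"
    using holomorphic_convex_primitive'[OF convex_ball open_ball h] by blast
  have H: "(H has_field_derivative h x) (at x)" if "x \<in> ball a e" for x
    using H0[OF that] unfolding at_within_open[OF that open_ball] .
  have "((\<lambda>x. g x * exp (- H x)) has_field_derivative 0) (at x within ball a e)" if "x \<in> ball a e" for x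
    by (rule has_field_derivative_at_within)
       (auto intro!: derivative_eq_intros g[OF that] H[OF that])
  then have "\<exists>k. \<forall>x\<in>ball a e. g x * exp (- H x) = k"
    by (rule has_field_derivative_zero_constant[OF convex_ball])
  then obtain k where k: "\<forall>x\<in>ball a e. g x * exp (- H x) = k" by blast
  have "g \<zeta> * exp (- H \<zeta>) = g \<zeta>' * exp (- H \<zeta>')" using k z by (metis (no_types))
  then show ?thesis by (metis exp_not_eq_zero mult_eq_0_iff)
qed

text \<open>The leaves off the line \<open>x = 0\<close> are the level sets \<open>(x + y) e\<^bsup>1/x\<^esup> / y = e\<^sup>c\<close> of a first
  integral; written without the denominator, the equation also makes sense on \<open>y = 0\<close>.\<close>

definition leaf_eq :: "complex \<Rightarrow> complex2 \<Rightarrow> complex" where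
  "leaf_eq c z = fst z + snd z - exp (c - 1 / fst z) * snd z"

text \<open>Differentiated along the foliation, the equation of an invariant curve is multiplied by
  a cofactor; here the cofactor is -(y - x^2) x' / x^3, regular off x = 0.\<close>

lemma leaf_eq_dichotomy:
  assumes X: "X holomorphic_on ball a e" and Y: "Y holomorphic_on ball a e"
    and ne: "\<And>\<zeta>. \<zeta> \<in> ball a e \<Longrightarrow> X \<zeta> \<noteq> 0"
    and tan: "\<And>\<zeta>. \<zeta> \<in> ball a e \<Longrightarrow>
      germ_P (X \<zeta>, Y \<zeta>) * deriv X \<zeta> - germ_Q (X \<zeta>, Y \<zeta>) * deriv Y \<zeta> = 0"
    and z: "\<zeta> \<in> ball a e" "\<zeta>' \<in> ball a e"
  shows "leaf_eq c (X \<zeta>, Y \<zeta>) = 0 \<longleftrightarrow> leaf_eq c (X \<zeta>', Y \<zeta>') = 0"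
proof (rule linear_ode_zero_or_nonzero[where
    h = "\<lambda>\<zeta>. - deriv X \<zeta> * (Y \<zeta> - X \<zeta> ^ 2) / X \<zeta> ^ 3" and g = "\<lambda>\<zeta>. leaf_eq c (X \<zeta>, Y \<zeta>)", OF _ _ z])
  show "(\<lambda>\<zeta>. - deriv X \<zeta> * (Y \<zeta> - X \<zeta> ^ 2) / X \<zeta> ^ 3) holomorphic_on ball a e"
    by (intro holomorphic_intros X Y open_ball) (use ne in auto)
  fix \<zeta> assume \<zeta>: "\<zeta> \<in> ball a e"
  define x y x' y' E where "x = X \<zeta>" "y = Y \<zeta>" "x' = deriv X \<zeta>" "y' = deriv Y \<zeta>" "E = exp (c - 1 / X \<zeta>)"
  note defs = this
  have x: "x \<noteq> 0" using ne[OF \<zeta>] by (simp add: defs)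
  have DX: "(X has_field_derivative x') (at \<zeta>)" and DY: "(Y has_field_derivative y') (at \<zeta>)"
    unfolding defs by (rule holomorphic_derivI[OF _ open_ball \<zeta>], fact)+
  have t: "x ^ 3 * y' = (x ^ 2 * y - y * (x + y)) * x'"
    using tan[OF \<zeta>] by (simp add: defs germ_P_def germ_Q_def algebra_simps)
  have "((\<lambda>\<zeta>. leaf_eq c (X \<zeta>, Y \<zeta>)) has_field_derivative
      x' + y' - (E * y' + E * (x' / x ^ 2) * y)) (at \<zeta>)"
    unfolding leaf_eq_def fst_conv snd_conv
    by (rule derivative_eq_intros DX DY refl | use x in \<open>simp add: defs power2_eq_square\<close>)+
  moreover have "x' + y' - (E * y' + E * (x' / x ^ 2) * y) = - x' * (y - x ^ 2) / x ^ 3 * (x + y - E * y)"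
  proof -
    have "x ^ 3 * (x' + y' - (E * y' + E * (x' / x ^ 2) * y)) =
        x ^ 3 * x' + x ^ 3 * y' * (1 - E) - E * x * x' * y"
      using x by (simp add: field_simps power2_eq_square power3_eq_cube)
    also have "\<dots> = - x' * (y - x ^ 2) * (x + y - E * y)"
      unfolding t by (simp add: algebra_simps power2_eq_square power3_eq_cube)
    finally show ?thesis using x by (simp add: field_simps)
  qed
  ultimately show "((\<lambda>\<zeta>. leaf_eq c (X \<zeta>, Y \<zeta>)) has_field_derivative
      - deriv X \<zeta> * (Y \<zeta> - X \<zeta> ^ 2) / X \<zeta> ^ 3 * leaf_eq c (X \<zeta>, Y \<zeta>)) (at \<zeta>)"
    by (simp add: leaf_eq_def defs)
qed

text \<open>The axis x = 0, where the first integral has an essential singularity, needs its own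
  equation: tangency reads x' = -(x^2 y' / P) x wherever P does not vanish.\<close>

lemma vertical_axis_dichotomy:
  assumes X: "X holomorphic_on ball a e" and Y: "Y holomorphic_on ball a e"
    and ne: "\<And>\<zeta>. \<zeta> \<in> ball a e \<Longrightarrow> germ_P (X \<zeta>, Y \<zeta>) \<noteq> 0"
    and tan: "\<And>\<zeta>. \<zeta> \<in> ball a e \<Longrightarrow>
      germ_P (X \<zeta>, Y \<zeta>) * deriv X \<zeta> - germ_Q (X \<zeta>, Y \<zeta>) * deriv Y \<zeta> = 0"
    and z: "\<zeta> \<in> ball a e" "\<zeta>' \<in> ball a e"
  shows "X \<zeta> = 0 \<longleftrightarrow> X \<zeta>' = 0"
proof (rule linear_ode_zero_or_nonzero[where
    h = "\<lambda>\<zeta>. - (X \<zeta> ^ 2) * deriv Y \<zeta> / germ_P (X \<zeta>, Y \<zeta>)" and g = X, OF _ _ z])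
  have "(\<lambda>\<zeta>. germ_P (X \<zeta>, Y \<zeta>)) holomorphic_on ball a e"
    by (rule holomorphic2_on_compose[OF germ_holomorphic(1)[OF open_UNIV]]) (use X Y in auto)
  then show "(\<lambda>\<zeta>. - (X \<zeta> ^ 2) * deriv Y \<zeta> / germ_P (X \<zeta>, Y \<zeta>)) holomorphic_on ball a e"
    by (intro holomorphic_intros X Y open_ball) (use ne in auto)
  fix \<zeta> assume \<zeta>: "\<zeta> \<in> ball a e"
  have "deriv X \<zeta> = - (X \<zeta> ^ 2) * deriv Y \<zeta> / germ_P (X \<zeta>, Y \<zeta>) * X \<zeta>"
    using tan[OF \<zeta>] ne[OF \<zeta>]
    by (simp add: germ_Q_def field_simps power2_eq_square power3_eq_cube eq_neg_iff_add_eq_0)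
  then show "(X has_field_derivative - (X \<zeta> ^ 2) * deriv Y \<zeta> / germ_P (X \<zeta>, Y \<zeta>) * X \<zeta>) (at \<zeta>)"
    using holomorphic_derivI[OF X open_ball \<zeta>] by simp
qed

lemma germ_P_vertical_axis: "y \<noteq> 0 \<Longrightarrow> germ_P (0, y) \<noteq> 0"
  by (simp add: germ_P_def)

lemma tangent_disc_locally_vertical:
  assumes \<gamma>: "(fst \<circ> \<gamma>) holomorphic_on ball 0 1" "(snd \<circ> \<gamma>) holomorphic_on ball 0 1"
    "tangent_disc germ_P germ_Q \<gamma>"
    and \<zeta>: "\<zeta> \<in> ball 0 1" "fst (\<gamma> \<zeta>) = 0" "snd (\<gamma> \<zeta>) \<noteq> 0"
  shows "\<exists>e>0. ball \<zeta> e \<subseteq> ball 0 1 \<and> (\<forall>\<xi>\<in>ball \<zeta> e. fst (\<gamma> \<xi>) = 0)"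
proof -
  have "(\<lambda>\<xi>. germ_P ((fst \<circ> \<gamma>) \<xi>, (snd \<circ> \<gamma>) \<xi>)) holomorphic_on ball 0 1"
    by (rule holomorphic2_on_compose[OF germ_holomorphic(1)[OF open_UNIV]]) (use \<gamma> in \<open>simp_all add: o_def\<close>)
  then have "isCont (\<lambda>\<xi>. germ_P ((fst \<circ> \<gamma>) \<xi>, (snd \<circ> \<gamma>) \<xi>)) \<zeta>"
    using \<zeta>(1) holomorphic_on_imp_continuous_on continuous_on_eq_continuous_at open_ball by blast
  moreover have "germ_P ((fst \<circ> \<gamma>) \<zeta>, (snd \<circ> \<gamma>) \<zeta>) \<noteq> 0" using \<zeta> germ_P_vertical_axis by simp
  ultimately have "\<exists>e>0. \<forall>\<xi>. dist \<zeta> \<xi> < e \<longrightarrow> germ_P ((fst \<circ> \<gamma>) \<xi>, (snd \<circ> \<gamma>) \<xi>) \<noteq> 0"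
    by (rule continuous_at_avoid)
  then obtain e1 where e1: "e1 > 0" "\<And>\<xi>. dist \<zeta> \<xi> < e1 \<Longrightarrow> germ_P ((fst \<circ> \<gamma>) \<xi>, (snd \<circ> \<gamma>) \<xi>) \<noteq> 0"
    by blast
  obtain e2 where e2: "e2 > 0" "ball \<zeta> e2 \<subseteq> ball 0 1" using \<zeta>(1) open_ball open_contains_ball by metis
  define e where "e = min e1 e2"
  have sub: "ball \<zeta> e \<subseteq> ball 0 1" and e: "e > 0" using e2 e1 by (auto simp: e_def)
  have "fst (\<gamma> \<xi>) = 0" if "\<xi> \<in> ball \<zeta> e" for \<xi>
  proof -
    have "(fst \<circ> \<gamma>) \<zeta> = 0 \<longleftrightarrow> (fst \<circ> \<gamma>) \<xi> = 0"
    proof (rule vertical_axis_dichotomy[where X = "fst \<circ> \<gamma>" and Y = "snd \<circ> \<gamma>" and a = \<zeta> and e = e])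
      fix \<xi> assume \<xi>: "\<xi> \<in> ball \<zeta> e"
      show "germ_P ((fst \<circ> \<gamma>) \<xi>, (snd \<circ> \<gamma>) \<xi>) \<noteq> 0" using e1(2) \<xi> by (simp add: e_def)
      show "germ_P ((fst \<circ> \<gamma>) \<xi>, (snd \<circ> \<gamma>) \<xi>) * deriv (fst \<circ> \<gamma>) \<xi> -
          germ_Q ((fst \<circ> \<gamma>) \<xi>, (snd \<circ> \<gamma>) \<xi>) * deriv (snd \<circ> \<gamma>) \<xi> = 0"
        using \<gamma>(3) \<xi> sub unfolding tangent_disc_def by auto
    qed (use \<gamma> sub that e in \<open>auto simp: o_def intro: holomorphic_on_subset\<close>)
    then show ?thesis using \<zeta> by simp
  qed
  with e sub show ?thesis by blast
qed

lemma tangent_disc_locally_leaf: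
  assumes \<gamma>: "(fst \<circ> \<gamma>) holomorphic_on ball 0 1" "(snd \<circ> \<gamma>) holomorphic_on ball 0 1"
    "tangent_disc germ_P germ_Q \<gamma>"
    and \<zeta>: "\<zeta> \<in> ball 0 1" "fst (\<gamma> \<zeta>) \<noteq> 0"
  shows "\<exists>e>0. ball \<zeta> e \<subseteq> ball 0 1 \<and> (\<forall>\<xi>\<in>ball \<zeta> e. fst (\<gamma> \<xi>) \<noteq> 0 \<and>
    (leaf_eq c (\<gamma> \<xi>) = 0 \<longleftrightarrow> leaf_eq c (\<gamma> \<zeta>) = 0))"
proof -
  have "isCont (fst \<circ> \<gamma>) \<zeta>"
    using \<zeta>(1) \<gamma>(1) holomorphic_on_imp_continuous_on continuous_on_eq_continuous_at open_ball by blast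
  moreover have "(fst \<circ> \<gamma>) \<zeta> \<noteq> 0" using \<zeta> by simp
  ultimately have "\<exists>e>0. \<forall>\<xi>. dist \<zeta> \<xi> < e \<longrightarrow> (fst \<circ> \<gamma>) \<xi> \<noteq> 0"
    by (rule continuous_at_avoid)
  then obtain e1 where e1: "e1 > 0" "\<And>\<xi>. dist \<zeta> \<xi> < e1 \<Longrightarrow> (fst \<circ> \<gamma>) \<xi> \<noteq> 0"
    by blast
  obtain e2 where e2: "e2 > 0" "ball \<zeta> e2 \<subseteq> ball 0 1" using \<zeta>(1) open_ball open_contains_ball by metis
  define e where "e = min e1 e2"
  have sub: "ball \<zeta> e \<subseteq> ball 0 1" and e: "e > 0" using e2 e1 by (auto simp: e_def)
  have ne: "(fst \<circ> \<gamma>) \<xi> \<noteq> 0" if "\<xi> \<in> ball \<zeta> e" for \<xi>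
    using e1(2) that by (simp add: e_def)
  have const: "leaf_eq c (\<gamma> \<xi>) = 0 \<longleftrightarrow> leaf_eq c (\<gamma> \<zeta>) = 0" if "\<xi> \<in> ball \<zeta> e" for \<xi>
  proof -
    have "leaf_eq c ((fst \<circ> \<gamma>) \<xi>, (snd \<circ> \<gamma>) \<xi>) = 0 \<longleftrightarrow> leaf_eq c ((fst \<circ> \<gamma>) \<zeta>, (snd \<circ> \<gamma>) \<zeta>) = 0"
    proof (rule leaf_eq_dichotomy[where X = "fst \<circ> \<gamma>" and Y = "snd \<circ> \<gamma>" and a = \<zeta> and e = e])
      fix \<xi> assume \<xi>: "\<xi> \<in> ball \<zeta> e"
      show "(fst \<circ> \<gamma>) \<xi> \<noteq> 0" using ne[OF \<xi>] .
      show "germ_P ((fst \<circ> \<gamma>) \<xi>, (snd \<circ> \<gamma>) \<xi>) * deriv (fst \<circ> \<gamma>) \<xi> -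
          germ_Q ((fst \<circ> \<gamma>) \<xi>, (snd \<circ> \<gamma>) \<xi>) * deriv (snd \<circ> \<gamma>) \<xi> = 0"
        using \<gamma>(3) \<xi> sub unfolding tangent_disc_def by auto
    qed (use \<gamma> sub that e in \<open>auto simp: o_def intro: holomorphic_on_subset\<close>)
    then show ?thesis by simp
  qed
  have ne': "fst (\<gamma> \<xi>) \<noteq> 0" if "\<xi> \<in> ball \<zeta> e" for \<xi>
    using ne[OF that] by simp
  show ?thesis using e sub ne' const by blast
qed

text \<open>The axis is excluded explicitly: there 1 / 0 = 0 would give \<open>leaf_eq\<close> the
  meaningless value (1 - e^c) y.\<close>

definition leaf_set :: "complex \<Rightarrow> complex2 set" where
  "leaf_set c = {z. fst z \<noteq> 0 \<and> leaf_eq c z = 0}"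

lemma leaf_set_locally_constant:
  assumes "holomorphic_disc \<gamma> (regular_points germ_P germ_Q W)" "tangent_disc germ_P germ_Q \<gamma>"
    and \<zeta>: "\<zeta> \<in> ball 0 1"
  shows "\<exists>e>0. ball \<zeta> e \<subseteq> ball 0 1 \<and> (\<forall>\<xi>\<in>ball \<zeta> e. \<gamma> \<xi> \<in> leaf_set c \<longleftrightarrow> \<gamma> \<zeta> \<in> leaf_set c)"
proof (cases "fst (\<gamma> \<zeta>) = 0")
  case True
  have "\<gamma> \<zeta> \<in> regular_points germ_P germ_Q W" using assms(1) \<zeta> by (auto simp: holomorphic_disc_def)
  then have "snd (\<gamma> \<zeta>) \<noteq> 0"
    using True unfolding regular_points_def germ_common_zero by (auto simp: prod_eq_iff)
  then have "\<exists>e>0. ball \<zeta> e \<subseteq> ball 0 1 \<and> (\<forall>\<xi>\<in>ball \<zeta> e. fst (\<gamma> \<xi>) = 0)"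
    using assms(1) unfolding holomorphic_disc_def
    by (intro tangent_disc_locally_vertical assms(2) \<zeta> True) auto
  then obtain e where e: "e > 0" "ball \<zeta> e \<subseteq> ball 0 1" "\<forall>\<xi>\<in>ball \<zeta> e. fst (\<gamma> \<xi>) = 0" by blast
  show ?thesis
    by (intro exI[of _ e] conjI e ballI) (use e(3) True in \<open>simp add: leaf_set_def\<close>)
next
  case False
  have "\<exists>e>0. ball \<zeta> e \<subseteq> ball 0 1 \<and> (\<forall>\<xi>\<in>ball \<zeta> e. fst (\<gamma> \<xi>) \<noteq> 0 \<and>
      (leaf_eq c (\<gamma> \<xi>) = 0 \<longleftrightarrow> leaf_eq c (\<gamma> \<zeta>) = 0))"
    using assms(1) unfolding holomorphic_disc_def
    by (intro tangent_disc_locally_leaf assms(2) \<zeta> False) auto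
  then show ?thesis using False unfolding leaf_set_def by blast
qed

text \<open>The leaf topology is final for tangent discs, so it suffices that membership is locally
  constant along each of them. Being clopen, the set confines every leaf that it meets, whether or
  not it is a single leaf.\<close>

lemma leaf_set_clopen:
  fixes W :: "complex2 set"
  defines "X \<equiv> leaf_topology germ_P germ_Q W" and "V \<equiv> regular_points germ_P germ_Q W"
  shows "openin X (V \<inter> leaf_set c)" "closedin X (V \<inter> leaf_set c)"
proof -
  have *: "open {\<zeta> \<in> ball 0 1. \<gamma> \<zeta> \<in> V \<inter> leaf_set c}" "open {\<zeta> \<in> ball 0 1. \<gamma> \<zeta> \<in> V - leaf_set c}"
    if \<gamma>: "holomorphic_disc \<gamma> V" "tangent_disc germ_P germ_Q \<gamma>" for \<gamma>
  proof -
    have V: "\<gamma> \<xi> \<in> V" if "\<xi> \<in> ball 0 1" for \<xi> using \<gamma>(1) that by (auto simp: holomorphic_disc_def)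
    have loc: "\<exists>e>0. ball \<zeta> e \<subseteq> ball 0 1 \<and> (\<forall>\<xi>\<in>ball \<zeta> e. \<gamma> \<xi> \<in> leaf_set c \<longleftrightarrow> \<gamma> \<zeta> \<in> leaf_set c)"
      if "\<zeta> \<in> ball 0 1" for \<zeta>
      by (rule leaf_set_locally_constant[OF \<gamma>[unfolded V_def] that])
    show "open {\<zeta> \<in> ball 0 1. \<gamma> \<zeta> \<in> V \<inter> leaf_set c}"
      unfolding open_contains_ball
    proof
      fix \<zeta> assume z: "\<zeta> \<in> {\<zeta> \<in> ball 0 1. \<gamma> \<zeta> \<in> V \<inter> leaf_set c}"
      then obtain e where e: "e > 0" "ball \<zeta> e \<subseteq> ball 0 1" "\<forall>\<xi>\<in>ball \<zeta> e. \<gamma> \<xi> \<in> leaf_set c \<longleftrightarrow> \<gamma> \<zeta> \<in> leaf_set c"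
        using loc by blast
      have "\<gamma> \<xi> \<in> V \<inter> leaf_set c" if "\<xi> \<in> ball \<zeta> e" for \<xi>
        using V[OF subsetD[OF e(2) that]] bspec[OF e(3) that] z by blast
      then show "\<exists>e>0. ball \<zeta> e \<subseteq> {\<zeta> \<in> ball 0 1. \<gamma> \<zeta> \<in> V \<inter> leaf_set c}"
        using e(1,2) by blast
    qed
    show "open {\<zeta> \<in> ball 0 1. \<gamma> \<zeta> \<in> V - leaf_set c}"
      unfolding open_contains_ball
    proof
      fix \<zeta> assume z: "\<zeta> \<in> {\<zeta> \<in> ball 0 1. \<gamma> \<zeta> \<in> V - leaf_set c}"
      then obtain e where e: "e > 0" "ball \<zeta> e \<subseteq> ball 0 1" "\<forall>\<xi>\<in>ball \<zeta> e. \<gamma> \<xi> \<in> leaf_set c \<longleftrightarrow> \<gamma> \<zeta> \<in> leaf_set c"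
        using loc by blast
      have "\<gamma> \<xi> \<in> V - leaf_set c" if "\<xi> \<in> ball \<zeta> e" for \<xi>
        using V[OF subsetD[OF e(2) that]] bspec[OF e(3) that] z by blast
      then show "\<exists>e>0. ball \<zeta> e \<subseteq> {\<zeta> \<in> ball 0 1. \<gamma> \<zeta> \<in> V - leaf_set c}"
        using e(1,2) by blast
    qed
  qed
  show "openin X (V \<inter> leaf_set c)"
    unfolding X_def openin_leaf_topology using *(1) by (auto simp: V_def)
  have "openin X (V - leaf_set c)"
    unfolding X_def openin_leaf_topology using *(2) by (auto simp: V_def)
  moreover have "V - (V \<inter> leaf_set c) = V - leaf_set c" by blast
  ultimately show "closedin X (V \<inter> leaf_set c)"
    unfolding closedin_def X_def topspace_leaf_topology V_def by auto
qed

lemma connectedin_leaf_subset: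
  assumes "connectedin (leaf_topology germ_P germ_Q W) L" "p \<in> L" "p \<in> leaf_set c"
  shows "L \<subseteq> leaf_set c"
proof -
  have "L \<subseteq> regular_points germ_P germ_Q W"
    using assms(1) connectedin_subset_topspace topspace_leaf_topology by metis
  with connectedin_clopen_cases[OF assms(1) leaf_set_clopen(2,1)] assms(2,3) show ?thesis
    by (auto simp: disjnt_def)
qed

text \<open>At 1/x = c the exponential equals 1 and the equation collapses to x = 0.\<close>

lemma leaf_set_fst:
  assumes "z \<in> leaf_set c" shows "1 / fst z \<notin> {0, c}"
proof -
  have z: "fst z \<noteq> 0" "fst z + snd z = exp (c - 1 / fst z) * snd z"
    using assms by (auto simp: leaf_set_def leaf_eq_def)
  have "1 / fst z \<noteq> c" using z by auto
  then show ?thesis using z(1) by auto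
qed

lemma leaf_graph_in_leaf_set:
  assumes "z \<noteq> 0" "exp (c - z) \<noteq> 1"
  shows "leaf_graph c z \<in> leaf_set c"
  using assms by (auto simp: leaf_set_def leaf_eq_def leaf_graph_def field_simps)

section \<open>Continuous maps into and out of the leaf topology\<close>

lemma continuous_map_fst_leaf_topology:
  "continuous_map (leaf_topology P Q W) euclidean fst"
  unfolding continuous_map_def topspace_leaf_topology
proof (intro conjI allI impI)
  fix U :: "complex set" assume "openin euclidean U"
  then have U: "open U" by simp
  show "openin (leaf_topology P Q W) {x \<in> regular_points P Q W. fst x \<in> U}"
    unfolding openin_leaf_topology
  proof (intro conjI allI impI)
    fix \<gamma> assume \<gamma>: "holomorphic_disc \<gamma> (regular_points P Q W) \<and> tangent_disc P Q \<gamma>"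
    then have "continuous_on (ball 0 1) (fst \<circ> \<gamma>)"
      unfolding holomorphic_disc_def by (intro holomorphic_on_imp_continuous_on) simp
    then have "open (ball 0 1 \<inter> (fst \<circ> \<gamma>) -` U)"
      by (rule continuous_open_preimage[OF _ open_ball U])
    moreover have "ball 0 1 \<inter> (fst \<circ> \<gamma>) -` U = {\<zeta> \<in> ball 0 1. \<gamma> \<zeta> \<in> {x \<in> regular_points P Q W. fst x \<in> U}}"
      using \<gamma> by (auto simp: holomorphic_disc_def)
    ultimately show "open {\<zeta> \<in> ball 0 1. \<gamma> \<zeta> \<in> {x \<in> regular_points P Q W. fst x \<in> U}}" by simp
  qed auto
qed auto

lemma continuous_map_id_leaf_topology:
  "continuous_map (leaf_topology P Q W) euclidean (\<lambda>z. z)"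
  unfolding continuous_map_def topspace_leaf_topology
proof (intro conjI allI impI)
  fix U :: "complex2 set" assume "openin euclidean U"
  then have U: "open U" by simp
  show "openin (leaf_topology P Q W) {x \<in> regular_points P Q W. x \<in> U}"
    unfolding openin_leaf_topology
  proof (intro conjI allI impI)
    fix \<gamma> assume \<gamma>: "holomorphic_disc \<gamma> (regular_points P Q W) \<and> tangent_disc P Q \<gamma>"
    then have "continuous_on (ball 0 1) (\<lambda>\<zeta>. ((fst \<circ> \<gamma>) \<zeta>, (snd \<circ> \<gamma>) \<zeta>))"
      unfolding holomorphic_disc_def by (intro continuous_on_Pair holomorphic_on_imp_continuous_on) (simp_all add: o_def)
    then have "continuous_on (ball 0 1) \<gamma>" by simp
    then have "open (ball 0 1 \<inter> \<gamma> -` U)"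
      by (rule continuous_open_preimage[OF _ open_ball U])
    moreover have "ball 0 1 \<inter> \<gamma> -` U = {\<zeta> \<in> ball 0 1. \<gamma> \<zeta> \<in> {x \<in> regular_points P Q W. x \<in> U}}"
      using \<gamma> by (auto simp: holomorphic_disc_def)
    ultimately show "open {\<zeta> \<in> ball 0 1. \<gamma> \<zeta> \<in> {x \<in> regular_points P Q W. x \<in> U}}" by simp
  qed auto
qed auto

lemma leaf_graph_derivative:
  assumes "z \<noteq> 0" "exp (c - z) \<noteq> 1"
  defines "x \<equiv> 1 / z" and "y \<equiv> 1 / (z * (exp (c - z) - 1))"
  shows "((\<lambda>z. 1 / z) has_field_derivative - (x ^ 2)) (at z)"
    and "((\<lambda>z. 1 / (z * (exp (c - z) - 1))) has_field_derivative
           - (y ^ 2 * (exp (c - z) - 1 - z * exp (c - z)))) (at z)"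
    and "germ_P (x, y) * (- (x ^ 2)) - germ_Q (x, y) * (- (y ^ 2 * (exp (c - z) - 1 - z * exp (c - z)))) = 0"
proof -
  define m where "m = exp (c - z) - 1"
  have m: "m \<noteq> 0" "exp (c - z) = m + 1" using assms(2) by (auto simp: m_def)
  show "((\<lambda>z. 1 / z) has_field_derivative - (x ^ 2)) (at z)"
    unfolding x_def
    by (rule derivative_eq_intros refl assms(1) | simp add: power2_eq_square)+
  have "((\<lambda>z. z * (exp (c - z) - 1)) has_field_derivative exp (c - z) - 1 - z * exp (c - z)) (at z)"
    by (auto intro!: derivative_eq_intros)
  from DERIV_inverse'[OF this] show "((\<lambda>z. 1 / (z * (exp (c - z) - 1))) has_field_derivative
           - (y ^ 2 * (exp (c - z) - 1 - z * exp (c - z)))) (at z)"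
    using assms(1,2) by (simp add: y_def inverse_eq_divide power2_eq_square)
  have "y = 1 / (z * m)" by (simp add: y_def m_def)
  then have xz: "x * z = 1" and xy: "x = y * m" using assms(1) m(1) by (simp_all add: x_def)
  have "germ_P (x, y) * (- (x ^ 2)) - germ_Q (x, y) * (- (y ^ 2 * (m - z * (m + 1)))) =
      - (x ^ 2) * (y * (x + y) - x ^ 2 * y) - x ^ 2 * y ^ 2 * (x * m - (x * z) * (m + 1))"
    by (simp add: germ_P_def germ_Q_def algebra_simps power2_eq_square power3_eq_cube)
  also have "\<dots> = 0"
    unfolding xz by (simp add: xy algebra_simps power2_eq_square power3_eq_cube)
  finally show "germ_P (x, y) * (- (x ^ 2)) - germ_Q (x, y) * (- (y ^ 2 * (exp (c - z) - 1 - z * exp (c - z)))) = 0"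
    by (simp add: m)
qed

text \<open>Near each point of the domain the map is, up to rescaling, itself a tangent disc, and
  sets open in the leaf topology have open preimages under these by definition.\<close>

lemma continuous_map_leaf_graph:
  assumes Z: "open Z" "\<And>z. z \<in> Z \<Longrightarrow> z \<noteq> 0 \<and> exp (c - z) \<noteq> 1 \<and> leaf_graph c z \<in> W"
  shows "continuous_map (top_of_set Z) (leaf_topology germ_P germ_Q W) (leaf_graph c)"
proof -
  have reg: "leaf_graph c z \<in> regular_points germ_P germ_Q W" if "z \<in> Z" for z
    using Z(2)[OF that] unfolding regular_points_def germ_common_zero
    by (auto simp: leaf_graph_def zero_prod_def)
  show ?thesis
    unfolding continuous_map_def topspace_leaf_topology topspace_euclidean_subtopology
  proof (intro conjI allI impI funcsetI reg)
    fix A assume A: "openin (leaf_topology germ_P germ_Q W) A"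
    have "open {z \<in> Z. leaf_graph c z \<in> A}"
      unfolding open_contains_ball
    proof
      fix z0 assume z0: "z0 \<in> {z \<in> Z. leaf_graph c z \<in> A}"
      then obtain e where e: "e > 0" "ball z0 e \<subseteq> Z" using Z(1) open_contains_ball by blast
      \<comment> \<open>Tangent discs are parametrised by the unit disc, so the ball around
        \<open>z0\<close> is rescaled to it.\<close>
      define s where "s \<zeta> = z0 + of_real e * \<zeta>" for \<zeta> :: complex
      have s: "s \<zeta> \<in> Z" if "\<zeta> \<in> ball 0 1" for \<zeta>
        using e that by (intro subsetD[OF e(2)]) (simp add: s_def dist_norm norm_mult)
      have Ds: "(s has_field_derivative of_real e) (at \<zeta>)" for \<zeta>
        unfolding s_def by (auto intro!: derivative_eq_intros)
      define \<gamma> where "\<gamma> = leaf_graph c \<circ> s"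
      have comps: "fst \<circ> \<gamma> = (\<lambda>\<zeta>. 1 / s \<zeta>)" "snd \<circ> \<gamma> = (\<lambda>\<zeta>. 1 / (s \<zeta> * (exp (c - s \<zeta>) - 1)))"
        by (auto simp: \<gamma>_def leaf_graph_def)
      have D: "((fst \<circ> \<gamma>) has_field_derivative - ((1 / s \<zeta>) ^ 2) * of_real e) (at \<zeta>)"
          "((snd \<circ> \<gamma>) has_field_derivative
             - ((1 / (s \<zeta> * (exp (c - s \<zeta>) - 1))) ^ 2 * (exp (c - s \<zeta>) - 1 - s \<zeta> * exp (c - s \<zeta>))) * of_real e) (at \<zeta>)"
        if "\<zeta> \<in> ball 0 1" for \<zeta>
      proof -
        have n: "s \<zeta> \<noteq> 0" "exp (c - s \<zeta>) \<noteq> 1" using Z(2)[OF s[OF that]] by auto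
        show "((fst \<circ> \<gamma>) has_field_derivative - ((1 / s \<zeta>) ^ 2) * of_real e) (at \<zeta>)"
          unfolding comps by (rule DERIV_chain2[where g = s, OF leaf_graph_derivative(1)[OF n] Ds])
        show "((snd \<circ> \<gamma>) has_field_derivative
             - ((1 / (s \<zeta> * (exp (c - s \<zeta>) - 1))) ^ 2 * (exp (c - s \<zeta>) - 1 - s \<zeta> * exp (c - s \<zeta>))) * of_real e) (at \<zeta>)"
          unfolding comps by (rule DERIV_chain2[where g = s, OF leaf_graph_derivative(2)[OF n] Ds])
      qed
      have "holomorphic_disc \<gamma> (regular_points germ_P germ_Q W)"
        unfolding holomorphic_disc_def
      proof (intro conjI)
        show "(fst \<circ> \<gamma>) holomorphic_on ball 0 1" "(snd \<circ> \<gamma>) holomorphic_on ball 0 1"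
          using D holomorphic_on_open[OF open_ball] by blast+
        show "\<gamma> ` ball 0 1 \<subseteq> regular_points germ_P germ_Q W"
          using reg s by (auto simp: \<gamma>_def)
      qed
      moreover have "tangent_disc germ_P germ_Q \<gamma>"
        unfolding tangent_disc_def
      proof
        fix \<zeta> :: complex assume \<zeta>: "\<zeta> \<in> ball 0 1"
        note Zs = Z(2)[OF s[OF \<zeta>]]
        show "germ_P (\<gamma> \<zeta>) * deriv (fst \<circ> \<gamma>) \<zeta> - germ_Q (\<gamma> \<zeta>) * deriv (snd \<circ> \<gamma>) \<zeta> = 0"
          using leaf_graph_derivative(3)[of "s \<zeta>" c] Zs
          unfolding DERIV_imp_deriv[OF D(1)[OF \<zeta>]] DERIV_imp_deriv[OF D(2)[OF \<zeta>]] mult.assoc[symmetric]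
            left_diff_distrib[symmetric]
          by (simp add: \<gamma>_def leaf_graph_def)
      qed
      ultimately have "open {\<zeta> \<in> ball 0 1. \<gamma> \<zeta> \<in> A}"
        using A unfolding openin_leaf_topology by blast
      moreover have "0 \<in> {\<zeta> \<in> ball 0 1. \<gamma> \<zeta> \<in> A}" using z0 by (simp add: \<gamma>_def s_def)
      ultimately obtain k where k: "k > 0" "ball 0 k \<subseteq> {\<zeta> \<in> ball 0 1. \<gamma> \<zeta> \<in> A}"
        using open_contains_ball by blast
      have "z \<in> {z \<in> Z. leaf_graph c z \<in> A}" if z: "z \<in> ball z0 (e * k)" for z
      proof -
        define \<zeta> where "\<zeta> = (z - z0) / of_real e"
        have "\<zeta> \<in> ball 0 k" using z e by (simp add: \<zeta>_def norm_divide dist_norm norm_minus_commute field_simps)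
        then have "\<zeta> \<in> ball 0 1" "\<gamma> \<zeta> \<in> A" using k by auto
        moreover have "s \<zeta> = z" using e by (simp add: s_def \<zeta>_def)
        ultimately show ?thesis using s[of \<zeta>] by (simp add: \<gamma>_def)
      qed
      then show "\<exists>e>0. ball z0 e \<subseteq> {z \<in> Z. leaf_graph c z \<in> A}"
        using e k by (intro exI[of _ "e * k"]) auto
    qed
    then show "openin (top_of_set Z) {x \<in> Z. leaf_graph c x \<in> A}"
      by (intro open_subset) auto
  qed
qed

section \<open>Invariant curves near the origin\<close>

text \<open>Transversality to the sphere makes the differential of the local equation nonzero, so
  the curve has a chart; as this chart is a disc inside the curve, invariance makes it tangent to
  the foliation.\<close>

lemma zero_curve_disc:
  assumes ball: "milnor_ball f r" and S: "z \<in> zero_curve f r" "z \<noteq> 0" "norm z < r" and U: "open U" "z \<in> U"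
    and inv: "invariant_curve P Q (zero_curve f r)"
  obtains \<gamma> V where "open V" "z \<in> V" "(fst \<circ> \<gamma>) holomorphic_on ball 0 1" "(snd \<circ> \<gamma>) holomorphic_on ball 0 1"
    "tangent_disc P Q \<gamma>" "\<gamma> 0 = z" "\<gamma> ` ball 0 1 \<subseteq> zero_curve f r \<inter> U"
    "zero_curve f r \<inter> V \<subseteq> \<gamma> ` ball 0 1"
    "\<not> (deriv (fst \<circ> \<gamma>) 0 = 0 \<and> deriv (snd \<circ> \<gamma>) 0 = 0)"
proof -
  obtain g N where N: "z \<in> N" "g holomorphic2_on N" "\<forall>w\<in>N. f w = 0 \<longleftrightarrow> g w = 0" "transverse_to_sphere g z"
    using ball S(1,2) unfolding milnor_ball_def by blast
  \<comment> \<open>The open ball is included because the curve is cut off at radius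
    \<open>r\<close>, and the chart must stay inside it.\<close>
  define N' where "N' = N \<inter> (ball 0 r \<inter> U)"
  have oN': "open N'" using N(2) U(1) by (auto simp: N'_def holomorphic2_on_def)
  have g: "g holomorphic2_on N'" by (rule holomorphic2_on_subset[OF N(2) oN']) (simp add: N'_def)
  have zN': "z \<in> N'" using N(1) S(3) U(2) by (simp add: N'_def)
  have "f z = 0" using S(1) by (simp add: zero_curve_def)
  then have gz: "g z = 0" using N by blast
  have nz: "\<not> (pd1 g z = 0 \<and> pd2 g z = 0)" using N(4) by (auto simp: transverse_to_sphere_def)
  obtain \<gamma> V where \<gamma>: "open V" "z \<in> V" "(fst \<circ> \<gamma>) holomorphic_on ball 0 1" "(snd \<circ> \<gamma>) holomorphic_on ball 0 1"
    "\<gamma> 0 = z" "\<gamma> ` ball 0 1 \<subseteq> {w \<in> N'. g w = 0}" "{w \<in> V. g w = 0} \<subseteq> \<gamma> ` ball 0 1"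
    "\<not> (deriv (fst \<circ> \<gamma>) 0 = 0 \<and> deriv (snd \<circ> \<gamma>) 0 = 0)"
    by (rule zero_curve_chart[OF g zN' gz nz])
  have sub: "{w \<in> N'. g w = 0} \<subseteq> zero_curve f r \<inter> U"
    using N(3) by (auto simp: N'_def zero_curve_def)
  with \<gamma>(6) have img: "\<gamma> ` ball 0 1 \<subseteq> zero_curve f r \<inter> U" by (rule subset_trans)
  then have "holomorphic_disc \<gamma> (zero_curve f r)"
    using \<gamma>(3,4) unfolding holomorphic_disc_def by blast
  then have tan: "tangent_disc P Q \<gamma>" using inv unfolding invariant_curve_def by blast
  have "zero_curve f r \<inter> (V \<inter> N) \<subseteq> \<gamma> ` ball 0 1"
    using \<gamma>(7) N(3) by (auto simp: zero_curve_def)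
  moreover have "open (V \<inter> N)" "z \<in> V \<inter> N" using \<gamma>(1,2) N(1,2) by (auto simp: holomorphic2_on_def)
  ultimately show ?thesis using that[OF _ _ \<gamma>(3,4) tan \<gamma>(5) img _ \<gamma>(8)] by blast
qed

context
  fixes f :: "complex2 \<Rightarrow> complex" and r :: real and S :: "complex2 set"
  defines "S \<equiv> zero_curve f r"
  assumes contf: "continuous_on (cball 0 r) f"
    and ball: "milnor_ball f r" and inv: "invariant_curve germ_P germ_Q S"
begin

lemma zero_curve_compact: "compact S"
proof -
  have "closedin (top_of_set (cball 0 r)) (cball 0 r \<inter> f -` {0})"
    by (rule continuous_closedin_preimage[OF contf closed_singleton])
  then have "closed (cball 0 r \<inter> f -` {0})" using closedin_closed_trans closed_cball by blast
  moreover have "S = cball 0 r \<inter> f -` {0}" by (auto simp: S_def zero_curve_def)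
  moreover have "bounded S" by (rule bounded_subset[OF bounded_cball[of 0 r]]) (auto simp: S_def zero_curve_def)
  ultimately show ?thesis by (simp add: compact_eq_bounded_closed)
qed

text \<open>Off the origin the foliation is regular along the axis, which is a leaf; a branch of the
  invariant curve through such a point can only be the axis.\<close>

lemma zero_curve_vertical:
  assumes "(0, y) \<in> S" "y \<noteq> 0" "norm y < r"
  shows "\<exists>V. open V \<and> (0, y) \<in> V \<and> (\<forall>w\<in>S \<inter> V. fst w = 0)"
proof -
  have z: "(0, y) \<in> zero_curve f r" "(0, y) \<noteq> (0 :: complex2)" "norm ((0::complex), y) < r"
    using assms by (auto simp: S_def zero_prod_def norm_Pair)
  obtain \<gamma> V where \<gamma>: "open V" "(0, y) \<in> V" "(fst \<circ> \<gamma>) holomorphic_on ball 0 1" "(snd \<circ> \<gamma>) holomorphic_on ball 0 1"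
    "tangent_disc germ_P germ_Q \<gamma>" "\<gamma> 0 = (0, y)"
    "\<gamma> ` ball 0 1 \<subseteq> zero_curve f r \<inter> UNIV" "zero_curve f r \<inter> V \<subseteq> \<gamma> ` ball 0 1"
    by (rule zero_curve_disc[OF ball z open_UNIV UNIV_I inv[unfolded S_def]])
  have 0: "0 \<in> ball (0::complex) 1" "fst (\<gamma> 0) = 0" "snd (\<gamma> 0) \<noteq> 0" using assms \<gamma>(6) by auto
  obtain e where e: "e > 0" "ball 0 e \<subseteq> ball (0::complex) 1" "\<forall>\<xi>\<in>ball 0 e. fst (\<gamma> \<xi>) = 0"
    using tangent_disc_locally_vertical[OF \<gamma>(3-5) 0] by blast
  \<comment> \<open>Verticality is known near 0 only, but it takes the whole unit disc to cover the
    curve in \<open>V\<close>; the identity theorem extends it.\<close>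
  have "(fst \<circ> \<gamma>) \<xi> = 0" if "\<xi> \<in> ball 0 1" for \<xi>
    by (rule analytic_continuation_open[where s = "ball 0 e" and s' = "ball 0 1" and f = "fst \<circ> \<gamma>" and g = "\<lambda>_. 0"])
       (use e \<gamma>(3) that in auto)
  then have "\<forall>w\<in>S \<inter> V. fst w = 0"
    using \<gamma>(8) unfolding S_def by auto
  with \<gamma>(1,2) show ?thesis by blast
qed

text \<open>Compactness: the points of the curve with |y| = \<delta> off the axis cannot accumulate
  on the axis. The barrier keeps a branch with |y| < \<delta> from escaping while x stays
  small.\<close>

lemma zero_curve_barrier:
  assumes \<delta>: "0 < \<delta>" "\<delta> < r"
  obtains \<rho> where "\<rho> > 0" "\<And>w. w \<in> S \<Longrightarrow> norm (snd w) = \<delta> \<Longrightarrow> norm (fst w) < \<rho> \<Longrightarrow> fst w = 0"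
proof -
  define K where "K = {w \<in> S. norm (snd w) = \<delta> \<and> fst w \<noteq> 0}"
  have closedS: "closed S" using zero_curve_compact compact_imp_closed by blast
  have "closed (S \<inter> (\<lambda>w. norm (snd w)) -` {\<delta>})"
    by (intro closed_Int closedS continuous_closed_vimage closed_singleton continuous_intros)
  moreover have "K \<subseteq> S \<inter> (\<lambda>w. norm (snd w)) -` {\<delta>}" by (auto simp: K_def)
  ultimately have clK: "closure K \<subseteq> S \<inter> (\<lambda>w. norm (snd w)) -` {\<delta>}" by (rule closure_minimal[rotated])
  have comp: "compact (closure K)"
    using zero_curve_compact clK by (metis closed_closure compact_Int_closed inf.absorb_iff2 le_infE)
  have ne: "fst w \<noteq> 0" if w: "w \<in> closure K" for w
  proof
    assume "fst w = 0"
    then have w0: "w = (0, snd w)" by (simp add: prod_eq_iff)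
    have "w \<in> S" "norm (snd w) = \<delta>" using clK w by auto
    then have "(0, snd w) \<in> S" "snd w \<noteq> 0" "norm (snd w) < r" using w0 \<delta> by auto
    then obtain V where V: "open V" "(0, snd w) \<in> V" "\<forall>w\<in>S \<inter> V. fst w = 0"
      using zero_curve_vertical by blast
    have "w \<in> V" using V(2) w0 by simp
    then obtain u where "u \<in> K" "u \<in> V" using w V(1) closure_iff_nhds_not_empty by blast
    then show False using V(3) by (auto simp: K_def)
  qed
  show ?thesis
  proof (cases "closure K = {}")
    case True
    then have "K = {}" by (simp add: closure_eq_empty)
    show ?thesis
      by (rule that[of 1]) (use \<open>K = {}\<close> in \<open>auto simp: K_def\<close>)
  next
    case False
    have "continuous_on (closure K) (\<lambda>w. norm (fst w))" by (intro continuous_intros)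
    then have "\<exists>u\<in>closure K. \<forall>w\<in>closure K. norm (fst u) \<le> norm (fst w)"
      by (rule continuous_attains_inf[OF comp False])
    then obtain u where u: "u \<in> closure K" "\<forall>w\<in>closure K. norm (fst u) \<le> norm (fst w)" by blast
    show ?thesis
    proof (rule that[of "norm (fst u)"])
      show "norm (fst u) > 0" using ne[OF u(1)] by simp
      fix w assume w: "w \<in> S" "norm (snd w) = \<delta>" "norm (fst w) < norm (fst u)"
      show "fst w = 0"
      proof (rule ccontr)
        assume "fst w \<noteq> 0"
        then have "w \<in> closure K" using w closure_subset[of K] by (auto simp: K_def)
        then show False using u(2) w(3) by (auto dest: bspec)
      qed
    qed
  qed
qed

text \<open>Off x = 0 the foliation is transverse to the vertical direction, so x is a local
  coordinate on a smooth invariant branch.\<close>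

lemma zero_curve_locally_graph:
  assumes z: "z \<in> S" "fst z \<noteq> 0" "norm z < r" and leaf: "leaf_eq c z = 0" and U: "open U" "z \<in> U"
  shows "\<exists>e>0. \<forall>x\<in>ball (fst z) e. \<exists>y. (x, y) \<in> S \<inter> U \<and> leaf_eq c (x, y) = 0"
proof -
  have z': "z \<in> zero_curve f r" "z \<noteq> 0" using z by (auto simp: S_def)
  obtain \<gamma> V where \<gamma>: "(fst \<circ> \<gamma>) holomorphic_on ball 0 1" "(snd \<circ> \<gamma>) holomorphic_on ball 0 1"
    "tangent_disc germ_P germ_Q \<gamma>" "\<gamma> 0 = z" "\<gamma> ` ball 0 1 \<subseteq> zero_curve f r \<inter> U"
    "\<not> (deriv (fst \<circ> \<gamma>) 0 = 0 \<and> deriv (snd \<circ> \<gamma>) 0 = 0)"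
    by (rule zero_curve_disc[OF ball z' z(3) U inv[unfolded S_def]])
  have 0: "0 \<in> ball (0::complex) 1" "fst (\<gamma> 0) \<noteq> 0" using z \<gamma>(4) by auto
  obtain e where e: "e > 0" "ball 0 e \<subseteq> ball (0::complex) 1"
    "\<forall>\<xi>\<in>ball 0 e. fst (\<gamma> \<xi>) \<noteq> 0 \<and> (leaf_eq c (\<gamma> \<xi>) = 0 \<longleftrightarrow> leaf_eq c (\<gamma> 0) = 0)"
    using tangent_disc_locally_leaf[OF \<gamma>(1-3) 0, of c] by blast
  have tan0: "germ_P (\<gamma> 0) * deriv (fst \<circ> \<gamma>) 0 - germ_Q (\<gamma> 0) * deriv (snd \<circ> \<gamma>) 0 = 0"
    using \<gamma>(3) unfolding tangent_disc_def by simp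
  have "germ_Q (\<gamma> 0) \<noteq> 0" using z(2) by (simp add: \<gamma>(4) germ_Q_def)
  \<comment> \<open>If x' vanished, tangency would give Q y' = 0, hence y' = 0, against the
    regularity of the chart.\<close>
  with tan0 \<gamma>(6) have d0: "deriv (fst \<circ> \<gamma>) 0 \<noteq> 0" by auto
  have X: "(fst \<circ> \<gamma>) holomorphic_on ball 0 e" using \<gamma>(1) e(2) by (rule holomorphic_on_subset)
  have "\<not> (fst \<circ> \<gamma>) constant_on ball 0 e"
  proof
    assume "(fst \<circ> \<gamma>) constant_on ball 0 e"
    then obtain k where "\<And>\<xi>. \<xi> \<in> ball 0 e \<Longrightarrow> (fst \<circ> \<gamma>) \<xi> = k" unfolding constant_on_def by blast
    then have "\<forall>\<^sub>F \<xi> in nhds 0. (fst \<circ> \<gamma>) \<xi> = k"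
      using e(1) eventually_nhds_in_open[of "ball 0 e" 0] by (auto elim: eventually_mono)
    then have "deriv (fst \<circ> \<gamma>) 0 = deriv (\<lambda>_. k) 0" by (rule deriv_cong_ev) simp
    then show False using d0 by simp
  qed
  then have "open ((fst \<circ> \<gamma>) ` ball 0 e)"
    by (intro open_mapping_thm[OF X open_ball connected_ball open_ball subset_refl])
  moreover have "fst z \<in> (fst \<circ> \<gamma>) ` ball 0 e"
    using e(1) \<gamma>(4) by (intro image_eqI[of _ _ 0]) auto
  ultimately obtain d where d: "d > 0" "ball (fst z) d \<subseteq> (fst \<circ> \<gamma>) ` ball 0 e"
    using open_contains_ball by blast
  have "\<exists>y. (x, y) \<in> S \<inter> U \<and> leaf_eq c (x, y) = 0" if x: "x \<in> ball (fst z) d" for x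
  proof -
    obtain \<xi> where \<xi>: "\<xi> \<in> ball 0 e" "x = fst (\<gamma> \<xi>)" using subsetD[OF d(2) x] by auto
    have "\<gamma> \<xi> \<in> S \<inter> U" using \<gamma>(5) e(2) \<xi>(1) unfolding S_def by blast
    moreover have "leaf_eq c (\<gamma> \<xi>) = 0" using bspec[OF e(3) \<xi>(1)] \<gamma>(4) leaf by simp
    ultimately show ?thesis using \<xi>(2) by (intro exI[of _ "snd (\<gamma> \<xi>)"]) simp
  qed
  with d(1) show ?thesis by blast
qed

text \<open>The poles x = 1 / (c + 2 pi i n) accumulate at 0; at each of them the equation of the
  leaf reads x = 0.\<close>

lemma exists_small_pole:
  assumes "\<rho> > 0"
  obtains x :: complex where "x \<in> ball 0 \<rho> - {0}" "\<And>y. leaf_eq c (x, y) \<noteq> 0"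
proof -
  obtain n :: nat where n: "norm c + 1 / \<rho> < real n" using reals_Archimedean2 by blast
  define \<zeta> where "\<zeta> = c + 2 * of_real pi * \<i> * of_nat n"
  have "1 * real n \<le> 2 * pi * real n" using pi_gt3 by (intro mult_right_mono) auto
  also have "\<dots> = norm (2 * of_real pi * \<i> * of_nat n :: complex)" by (simp add: norm_mult)
  also have "\<dots> \<le> norm \<zeta> + norm c"
    using norm_triangle_ineq4[of \<zeta> c] by (simp add: \<zeta>_def)
  finally have big: "1 / \<rho> < norm \<zeta>" using n by simp
  then have "\<zeta> \<noteq> 0" using assms by auto
  have "exp (c - \<zeta>) = 1"
    unfolding exp_eq_1 by (intro conjI exI[of _ "- int n"]) (simp_all add: \<zeta>_def)
  then have "leaf_eq c (1 / \<zeta>, y) \<noteq> 0" for y using \<open>\<zeta> \<noteq> 0\<close> by (simp add: leaf_eq_def)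
  moreover have "1 / \<zeta> \<in> ball 0 \<rho> - {0}"
    using big \<open>\<zeta> \<noteq> 0\<close> assms by (simp add: norm_divide field_simps)
  ultimately show ?thesis using that by blast
qed

text \<open>A branch of the curve off the three separatrices would be a graph \<open>y = x / (e\<^bsup>c - 1/x\<^esup> - 1)\<close>;
  by the barrier it could be continued over a whole punctured disc, where this function has
  poles.\<close>

lemma zero_curve_in_separatrices:
  shows "\<exists>\<epsilon>>0. \<forall>w\<in>S. norm w < \<epsilon> \<longrightarrow> fst w = 0 \<or> snd w = 0 \<or> fst w + snd w = 0"
proof -
  have r: "r > 0" using ball by (simp add: milnor_ball_def)
  define \<delta> where "\<delta> = r / 2"
  have \<delta>: "0 < \<delta>" "\<delta> < r" using r by (auto simp: \<delta>_def)
  obtain \<rho>0 where \<rho>0: "\<rho>0 > 0" "\<And>w. w \<in> S \<Longrightarrow> norm (snd w) = \<delta> \<Longrightarrow> norm (fst w) < \<rho>0 \<Longrightarrow> fst w = 0"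
    using zero_curve_barrier[OF \<delta>] by blast
  \<comment> \<open>With |x| < r/2 and |y| < \<delta> = r/2 all points considered stay in the open
    ball of radius \<open>r\<close>, where the charts of the curve exist.\<close>
  define \<rho> where "\<rho> = min \<rho>0 (r / 2)"
  have \<rho>: "\<rho> > 0" "\<rho> \<le> \<rho>0" "\<rho> \<le> r / 2" using \<rho>0(1) r by (auto simp: \<rho>_def)
  have lines: "fst w = 0 \<or> snd w = 0 \<or> fst w + snd w = 0" if w: "w \<in> S" "norm w < min \<rho> \<delta>" for w
  proof (rule ccontr)
    assume "\<not> ?thesis"
    then have nz: "fst w \<noteq> 0" "snd w \<noteq> 0" "fst w + snd w \<noteq> 0" by auto
    \<comment> \<open>Any logarithm serves to put \<open>w\<close> on the level set of parameter
      \<open>c\<close>.\<close>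
    define c where "c = Ln ((fst w + snd w) / snd w) + 1 / fst w"
    have "exp (c - 1 / fst w) = (fst w + snd w) / snd w" using nz by (simp add: c_def)
    then have leaf: "leaf_eq c w = 0" using nz by (simp add: leaf_eq_def)
    define D where "D = ball (0::complex) \<rho> - {0}"
    \<comment> \<open>The abscissas over which the branch exists below height \<delta>. This set is
      shown to be open and closed in the punctured disc \<open>D\<close>, which is
      connected.\<close>
    define M where "M = {x \<in> D. \<exists>y. (x, y) \<in> S \<and> norm y < \<delta> \<and> leaf_eq c (x, y) = 0}"
    have oD: "open D" by (simp add: D_def open_delete)
    have connD: "connected D" unfolding D_def by (rule connected_punctured_ball) simp
    have "norm (fst w) \<le> norm w" "norm (snd w) \<le> norm w"
      by (cases w; simp add: norm_fst_le norm_snd_le)+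
    then have "norm (fst w) < \<rho>" "norm (snd w) < \<delta>"
      using w(2) by auto
    then have "fst w \<in> M"
      using w(1) leaf nz(1) by (auto simp: M_def D_def intro!: exI[of _ "snd w"])
    have openM: "open M"
      unfolding open_contains_ball
    proof
      fix x assume "x \<in> M"
      then obtain y where y: "x \<in> D" "(x, y) \<in> S" "norm y < \<delta>" "leaf_eq c (x, y) = 0" by (auto simp: M_def)
      define U where "U = {u :: complex2. norm (snd u) < \<delta>}"
      have "open U" unfolding U_def by (intro open_Collect_less continuous_intros)
      have "norm (x, y) \<le> norm x + norm y" by (rule norm_Pair_le)
      then have "norm (x, y) < r" using y(1,3) \<rho>(3) by (simp add: D_def \<delta>_def)
      then have "\<exists>e>0. \<forall>x'\<in>ball (fst (x, y)) e. \<exists>y. (x', y) \<in> S \<inter> U \<and> leaf_eq c (x', y) = 0"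
        using y(1,3) by (intro zero_curve_locally_graph[OF y(2) _ _ y(4) \<open>open U\<close>]) (auto simp: D_def U_def)
      then obtain e where e: "e > 0" "\<forall>x'\<in>ball x e. \<exists>y. (x', y) \<in> S \<inter> U \<and> leaf_eq c (x', y) = 0"
        unfolding fst_conv by blast
      obtain e' where e': "e' > 0" "ball x e' \<subseteq> D" using oD y(1) open_contains_ball by blast
      have "x' \<in> M" if "x' \<in> ball x (min e e')" for x'
      proof -
        have x': "x' \<in> ball x e" "x' \<in> ball x e'" using that by auto
        obtain y' where "(x', y') \<in> S" "norm y' < \<delta>" "leaf_eq c (x', y') = 0"
          using bspec[OF e(2) x'(1)] by (auto simp: U_def)
        moreover have "x' \<in> D" using e'(2) x'(2) by blast
        ultimately show ?thesis unfolding M_def by blast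
      qed
      then show "\<exists>e>0. ball x e \<subseteq> M"
        using e(1) e'(1) by (intro exI[of _ "min e e'"]) auto
    qed
    have closedM: "x \<in> M" if x: "x \<in> D" "x \<in> closure M" for x
    proof -
      obtain s where s: "\<And>n. s n \<in> M" "s \<longlonglongrightarrow> x" using x(2) unfolding closure_sequential by blast
      have "\<exists>y. (s n, y) \<in> S \<and> norm y < \<delta> \<and> leaf_eq c (s n, y) = 0" for n using s(1)[of n] by (simp add: M_def)
      then obtain y where y: "\<And>n. (s n, y n) \<in> S" "\<And>n. norm (y n) < \<delta>" "\<And>n. leaf_eq c (s n, y n) = 0"
        by metis
      have "\<exists>l\<in>S. \<exists>k. strict_mono k \<and> ((\<lambda>n. (s n, y n)) \<circ> k) \<longlonglongrightarrow> l"
        by (rule zero_curve_compact[unfolded compact_def, rule_format]) (rule y(1))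
      then obtain l k where l: "l \<in> S" "strict_mono k" "((\<lambda>n. (s n, y n)) \<circ> k) \<longlonglongrightarrow> l"
        by blast
      have "(\<lambda>n. s (k n)) \<longlonglongrightarrow> fst l" using tendsto_fst[OF l(3)] by (simp add: o_def)
      moreover have "(\<lambda>n. s (k n)) \<longlonglongrightarrow> x" using LIMSEQ_subseq_LIMSEQ[OF s(2) l(2)] by (simp add: o_def)
      ultimately have fl: "fst l = x" by (rule LIMSEQ_unique)
      have sl: "(\<lambda>n. y (k n)) \<longlonglongrightarrow> snd l" using tendsto_snd[OF l(3)] by (simp add: o_def)
      have "norm (snd l) \<le> \<delta>"
        by (rule LIMSEQ_le_const2[OF tendsto_norm[OF sl]]) (use y(2) in \<open>auto intro: less_imp_le\<close>)
      \<comment> \<open>The barrier at work: a limit at height \<delta> would have to lie on x = 0,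
        but x is in the punctured disc.\<close>
      moreover have "norm (snd l) \<noteq> \<delta>"
        using \<rho>0(2)[OF l(1)] x(1) \<rho>(2) fl by (auto simp: D_def)
      moreover have "leaf_eq c l = 0"
      proof -
        have "(\<lambda>n. leaf_eq c (s (k n), y (k n))) \<longlonglongrightarrow> leaf_eq c l"
          unfolding leaf_eq_def fst_conv snd_conv using x(1) fl
          by (intro tendsto_intros sl \<open>(\<lambda>n. s (k n)) \<longlonglongrightarrow> fst l\<close>) (simp add: D_def)
        then show ?thesis using y(3) by (simp add: LIMSEQ_const_iff)
      qed
      moreover have "l = (x, snd l)" using fl by (simp add: prod_eq_iff)
      ultimately show ?thesis using x(1) l(1) unfolding M_def by (metis (mono_tags, lifting) mem_Collect_eq order_less_le)
    qed
    have "D \<subseteq> M"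
    proof -
      have "M \<inter> D = {} \<or> (- closure M) \<inter> D = {}"
        by (rule connectedD[OF connD openM]) (use closedM closure_subset[of M] in auto)
      moreover have "M \<inter> D \<noteq> {}" using \<open>fst w \<in> M\<close> by (auto simp: M_def)
      ultimately show ?thesis using closedM by blast
    qed
    moreover obtain x where "x \<in> D" "\<And>y. leaf_eq c (x, y) \<noteq> 0"
      using exists_small_pole[OF \<rho>(1), of c] unfolding D_def by blast
    ultimately show False unfolding M_def by blast
  qed
  have "min \<rho> \<delta> > 0" using \<rho>(1) \<delta>(1) by simp
  with lines show ?thesis by blast
qed

end

section \<open>Compressibility\<close>

lemma loop_class_eqI:
  assumes "homotopic_with (\<lambda>h. pathstart h = p \<and> pathfinish h = p) (top_of_set {0..1}) X \<gamma> \<delta>"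
  shows "loop_class X p \<gamma> = loop_class X p \<delta>"
  using homotopic_with_trans[OF assms] homotopic_with_trans[OF homotopic_with_symD[OF assms]]
  unfolding loop_class_def by blast

lemma loop_class_refl: "\<gamma> \<in> loops_at X p \<Longrightarrow> \<gamma> \<in> loop_class X p \<gamma>"
  by (simp add: loop_class_def loops_at_def pathin_def)

text \<open>The union defining \<open>inclusion_pi1\<close> ranges over equal classes, since a
  homotopy in the finer space is one in the larger space.\<close>

lemma inclusion_pi1_loop_class:
  assumes id: "continuous_map X Y (\<lambda>z. z)" and \<gamma>: "\<gamma> \<in> loops_at X p"
  shows "inclusion_pi1 Y p (loop_class X p \<gamma>) = loop_class Y p \<gamma>"
proof -
  have "loop_class Y p \<delta> = loop_class Y p \<gamma>" if "\<delta> \<in> loop_class X p \<gamma>" for \<delta>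
  proof -
    have "homotopic_with (\<lambda>h. pathstart h = p \<and> pathfinish h = p) (top_of_set {0..1}) X \<gamma> \<delta>"
      using that by (simp add: loop_class_def)
    from homotopic_with_compose_continuous_map_left[OF this id,
        where q = "\<lambda>h. pathstart h = p \<and> pathfinish h = p"]
    have "homotopic_with (\<lambda>h. pathstart h = p \<and> pathfinish h = p) (top_of_set {0..1}) Y \<gamma> \<delta>"
      by (simp add: o_def)
    then show ?thesis using loop_class_eqI by metis
  qed
  then show ?thesis
    using loop_class_refl[OF \<gamma>] unfolding inclusion_pi1_def by blast
qed

text \<open>The obstruction lives in an arbitrarily small ball around 0 inside U, so it appears for
  every radius.\<close>

lemma germ_not_incompressible_in_ball: "\<not> incompressible_in_ball germ_P germ_Q r"
proof
  assume "incompressible_in_ball germ_P germ_Q r"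
  then obtain W f \<eta>0 U where W: "cball 0 r \<subseteq> W" "germ_P holomorphic2_on W" "f holomorphic2_on W"
    and reg: "cball 0 r - {0} \<subseteq> regular_points germ_P germ_Q W"
    and inv: "invariant_curve germ_P germ_Q (zero_curve f r)"
    and mil: "milnor_radius f r \<eta>0" and U0: "0 \<in> interior U" and UT: "U \<subseteq> tube f r \<eta>0"
    and inj: "\<forall>L \<in> leaves germ_P germ_Q W (U - zero_curve f r). \<forall>p\<in>L.
      inj_on (inclusion_pi1 (top_of_set (U - zero_curve f r)) p)
        (carrier (fundamental_group (subtopology (leaf_topology germ_P germ_Q W) L) p))"
    unfolding incompressible_in_ball_def Let_def by (elim exE conjE) (rule that; assumption)
  have ball: "milnor_ball f r" using mil by (simp add: milnor_radius_def)
  have contf: "continuous_on (cball 0 r) f"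
    using holomorphic2_on_continuous_on[OF W(3)] W(1) by (rule continuous_on_subset)
  define Y where "Y = U - zero_curve f r"
  define X where "X = leaf_topology germ_P germ_Q W"
  obtain \<epsilon>0 where \<epsilon>0: "\<epsilon>0 > 0"
    "\<forall>w\<in>zero_curve f r. norm w < \<epsilon>0 \<longrightarrow> fst w = 0 \<or> snd w = 0 \<or> fst w + snd w = 0"
    using zero_curve_in_separatrices[OF contf ball inv] by blast
  obtain \<epsilon>1 where \<epsilon>1: "\<epsilon>1 > 0" "ball 0 \<epsilon>1 \<subseteq> U" using U0 unfolding mem_interior by blast
  define \<epsilon> where "\<epsilon> = min \<epsilon>0 \<epsilon>1"
  have "\<epsilon> > 0" using \<epsilon>0 \<epsilon>1 by (simp add: \<epsilon>_def)
  then obtain \<kappa> c where \<kappa>: "path \<kappa>" "pathfinish \<kappa> = pathstart \<kappa>"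
    "\<forall>z\<in>path_image \<kappa>. z \<noteq> 0 \<and> exp (c - z) \<noteq> 1"
    "\<forall>a. \<not> homotopic_paths (- {0, c}) \<kappa> (\<lambda>_. a)"
    and null: "homotopic_paths {z. norm z < \<epsilon> \<and> fst z \<noteq> 0 \<and> snd z \<noteq> 0 \<and> fst z + snd z \<noteq> 0}
       (leaf_graph c \<circ> \<kappa>) (\<lambda>_. leaf_graph c (pathstart \<kappa>))"
    using small_null_homotopic_loop by blast
  define \<gamma> where "\<gamma> = leaf_graph c \<circ> \<kappa>"
  define p where "p = leaf_graph c (pathstart \<kappa>)"
  have ends: "pathstart \<gamma> = p" "pathfinish \<gamma> = p"
    by (simp_all add: \<gamma>_def p_def pathstart_compose pathfinish_compose \<kappa>(2))
  have "{z. norm z < \<epsilon> \<and> fst z \<noteq> 0 \<and> snd z \<noteq> 0 \<and> fst z + snd z \<noteq> 0} \<subseteq> Y"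
    using \<epsilon>0(2) \<epsilon>1(2) by (auto simp: Y_def \<epsilon>_def subset_iff)
  with null have null: "homotopic_paths Y \<gamma> (\<lambda>_. p)"
    unfolding \<gamma>_def p_def by (rule homotopic_paths_subset)
  have \<gamma>Y: "path_image \<gamma> \<subseteq> Y" using homotopic_paths_imp_subset[OF null] by blast
  have YW: "Y \<subseteq> W" using UT W(1) unfolding Y_def tube_def by blast
  have oW: "open W" using W(2) by (simp add: holomorphic2_on_def)
  \<comment> \<open>An open domain around the image of \<open>\<kappa>\<close> on which
    \<open>leaf_graph c\<close> stays in \<open>W\<close>: \<open>continuous_map_leaf_graph\<close>
    needs room for discs, which a mere path does not offer.\<close>
  define Z where "Z = {z. z \<noteq> 0 \<and> exp (c - z) \<noteq> 1} \<inter> leaf_graph c -` W"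
  have "open Z"
    unfolding Z_def
  proof (rule continuous_open_preimage[OF _ _ oW])
    show "open {z. z \<noteq> 0 \<and> exp (c - z) \<noteq> 1}"
      by (intro open_Collect_conj open_Collect_neq continuous_intros)
    show "continuous_on {z. z \<noteq> 0 \<and> exp (c - z) \<noteq> 1} (leaf_graph c)"
      unfolding leaf_graph_def[abs_def] by (intro continuous_intros) auto
  qed
  then have contZ: "continuous_map (top_of_set Z) X (leaf_graph c)"
    unfolding X_def by (rule continuous_map_leaf_graph) (simp add: Z_def)
  have \<kappa>Z: "path_image \<kappa> \<subseteq> Z"
    using \<kappa>(3) \<gamma>Y YW by (auto simp: Z_def \<gamma>_def path_image_compose)
  have "continuous_map (top_of_set {0..1}) (top_of_set Z) \<kappa>"
    using \<kappa>(1) \<kappa>Z by (auto simp: path_def path_image_def continuous_map_in_subtopology)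
  then have pX: "pathin X \<gamma>"
    unfolding pathin_def \<gamma>_def using contZ by (rule continuous_map_compose)
  then have pXY: "pathin (subtopology X Y) \<gamma>"
    using \<gamma>Y by (auto simp: pathin_subtopology path_image_def)
  define L where "L = Collect (path_component_of (subtopology X Y) p)"
  have p_in: "p \<in> \<gamma> ` {0..1}" using ends(1) by (auto simp: pathstart_def intro!: image_eqI[of _ _ 0])
  have \<gamma>L: "\<gamma> ` {0..1} \<subseteq> L"
    unfolding L_def by (rule path_component_of_maximal[OF path_connectedin_path_image[OF pXY] p_in])
  then have pL: "p \<in> L" using p_in by blast
  have "p \<in> topspace (subtopology X Y)"
    using path_start_in_topspace[OF pXY] ends(1) by (simp add: pathstart_def)
  then have "L \<in> leaves germ_P germ_Q W Y"
    unfolding leaves_def path_components_of_def L_def X_def by blast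
  then have injL: "inj_on (inclusion_pi1 (top_of_set Y) p) (carrier (fundamental_group (subtopology X L) p))"
    using inj pL unfolding X_def Y_def by blast
  have "path_connectedin (subtopology X Y) L"
    unfolding L_def by (rule path_connectedin_path_component_of)
  then have "connectedin (subtopology X Y) L" by (rule path_connectedin_imp_connectedin)
  then have connL: "connectedin X L" and LY: "L \<subseteq> Y" by (auto simp: connectedin_subtopology)
  have pathstart_in: "pathstart \<kappa> \<noteq> 0 \<and> exp (c - pathstart \<kappa>) \<noteq> 1" using \<kappa>(3) pathstart_in_path_image by blast
  then have "p \<in> leaf_set c" unfolding p_def by (intro leaf_graph_in_leaf_set) auto
  with connL pL have L: "L \<subseteq> leaf_set c" unfolding X_def by (rule connectedin_leaf_subset)
  have loops: "\<gamma> \<in> loops_at (subtopology X L) p" "(\<lambda>_. p) \<in> loops_at (subtopology X L) p"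
  proof -
    show "\<gamma> \<in> loops_at (subtopology X L) p"
      using pX \<gamma>L ends by (auto simp: loops_at_def pathin_subtopology)
    have "p \<in> topspace X" using connectedin_subset_topspace[OF connL] pL by blast
    then show "(\<lambda>_. p) \<in> loops_at (subtopology X L) p"
      using pL by (simp add: loops_at_def pathstart_def pathfinish_def)
  qed
  have "continuous_map X euclidean (\<lambda>z. z)" unfolding X_def by (rule continuous_map_id_leaf_topology)
  then have id: "continuous_map (subtopology X L) (top_of_set Y) (\<lambda>z. z)"
    using LY by (auto simp: continuous_map_in_subtopology continuous_map_from_subtopology)
  have "homotopic_with (\<lambda>h. pathstart h = p \<and> pathfinish h = p) (top_of_set {0..1}) (top_of_set Y) \<gamma> (\<lambda>_. p)"
    using null unfolding homotopic_paths_def by (simp add: ends)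
  then have "loop_class (top_of_set Y) p \<gamma> = loop_class (top_of_set Y) p (\<lambda>_. p)" by (rule loop_class_eqI)
  then have "inclusion_pi1 (top_of_set Y) p (loop_class (subtopology X L) p \<gamma>) =
      inclusion_pi1 (top_of_set Y) p (loop_class (subtopology X L) p (\<lambda>_. p))"
    by (simp add: inclusion_pi1_loop_class[OF id] loops)
  then have "loop_class (subtopology X L) p \<gamma> = loop_class (subtopology X L) p (\<lambda>_. p)"
    by (rule inj_onD[OF injL]) (use loops in \<open>simp_all add: fundamental_group_def\<close>)
  then have "(\<lambda>_. p) \<in> loop_class (subtopology X L) p \<gamma>" using loop_class_refl[OF loops(2)] by simp
  then have hom: "homotopic_with (\<lambda>h. pathstart h = p \<and> pathfinish h = p) (top_of_set {0..1}) (subtopology X L) \<gamma> (\<lambda>_. p)"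
    by (simp add: loop_class_def)
  \<comment> \<open>A left inverse of \<open>leaf_graph c\<close>: it carries the null homotopy in
    the leaf back to the plane without 0 and c, where \<open>\<kappa>\<close> is not null
    homotopic.\<close>
  define \<phi> where "\<phi> z = 1 / fst z" for z :: complex2
  have \<phi>: "continuous_map (subtopology X L) (top_of_set (- {0, c})) \<phi>"
  proof -
    have fst: "continuous_map (subtopology X L) (top_of_set (- {0})) fst"
      unfolding continuous_map_in_subtopology
    proof
      show "continuous_map (subtopology X L) euclidean fst"
        unfolding X_def by (intro continuous_map_from_subtopology continuous_map_fst_leaf_topology)
      show "fst \<in> topspace (subtopology X L) \<rightarrow> - {0}" using L by (auto simp: leaf_set_def)
    qed
    have "continuous_map (top_of_set (- {0})) euclidean (\<lambda>z::complex. 1 / z)"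
      by (auto intro!: continuous_intros)
    from continuous_map_compose[OF fst this]
    have "continuous_map (subtopology X L) euclidean \<phi>" by (simp add: \<phi>_def[abs_def] o_def)
    moreover have "\<phi> \<in> topspace (subtopology X L) \<rightarrow> - {0, c}"
    proof
      fix z assume "z \<in> topspace (subtopology X L)"
      then have "z \<in> leaf_set c" using L by auto
      then show "\<phi> z \<in> - {0, c}" using leaf_set_fst by (simp add: \<phi>_def)
    qed
    ultimately show ?thesis by (simp add: continuous_map_in_subtopology)
  qed
  \<comment> \<open>Even z = 0 is covered, by 1 / 0 = 0; so the equality with
    \<open>\<kappa>\<close> below holds for whole functions, also outside the unit interval.\<close>
  have "\<phi> (leaf_graph c z) = z" for z by (simp add: \<phi>_def leaf_graph_def)
  then have "\<phi> \<circ> \<gamma> = \<kappa>" "\<phi> p = pathstart \<kappa>" by (simp_all add: \<gamma>_def p_def fun_eq_iff)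
  moreover have "homotopic_with (\<lambda>h. pathstart h = \<phi> p \<and> pathfinish h = \<phi> p) (top_of_set {0..1})
      (top_of_set (- {0, c})) (\<phi> \<circ> \<gamma>) (\<phi> \<circ> (\<lambda>_. p))"
    by (rule homotopic_with_compose_continuous_map_left[OF hom \<phi>]) (simp add: pathstart_compose pathfinish_compose)
  ultimately have "homotopic_paths (- {0, c}) \<kappa> (\<lambda>_. pathstart \<kappa>)"
    unfolding homotopic_paths_def by (simp add: \<kappa>(2) o_def)
  then show False using \<kappa>(4) by blast
qed

theorem mainTheorem2:
  shows "\<exists>P Q :: complex \<times> complex \<Rightarrow> complex.
    foliation_germ P Q \<and> singular_germ P Q \<and> non_dicritical P Q \<and> compressible P Q"
proof (intro exI conjI)
  show "foliation_germ germ_P germ_Q" by (rule germ_foliation)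
  show "singular_germ germ_P germ_Q" by (rule germ_singular)
  show "non_dicritical germ_P germ_Q" by (rule germ_non_dicritical)
  show "compressible germ_P germ_Q"
    by (simp add: incompressible_def germ_not_incompressible_in_ball)
qed

end
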